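(* Let $p,m\ge 1$ be integers, let $f\colon\mathbb{R}^p\to\mathbb{R}$ be a $2m$-times continuously differentiable function, and let $\mathbf{n}=(n_1,\dots,n_p)\in\mathbb{Z}_+^p$. Then $$\sum_{\mathbf{k}=\mathbf{0}}^{\mathbf{n}-\mathbf{1}}f(\mathbf{k})\Big[=\sum_{k_1=0}^{n_1-1}\cdots\sum_{k_p=0}^{n_p-1}f(k_1,\dots,k_p)\Big]=A_m-R_m,$$ where $A_m$ is given by any of the following six expressions, which are all equal to one another: $$A_m:=\sum_{\mathbf{j}=\mathbf{1}}^{m\mathbf{1}}\gamma_{m,\mathbf{j}}\sum_{\mathbf{i}=\mathbf{0}}^{\mathbf{j}-\mathbf{1}}\int_{\mathbf{i}-\mathbf{j}/2}^{\mathbf{n}-\mathbf{1}+\mathbf{j}/2-\mathbf{i}}d\mathbf{x}\,f(\mathbf{x})=\sum_{\mathbf{j}=\mathbf{1}}^{m\mathbf{1}}\gamma_{m,\mathbf{j}}\sum_{\mathbf{i}=\mathbf{0}}^{\mathbf{j}-\mathbf{1}}\int_{-\mathbf{1}+\mathbf{j}/2-\mathbf{i}}^{\mathbf{n}-\mathbf{1}+\mathbf{j}/2-\mathbf{i}}d\mathbf{x}\,f(\mathbf{x})$$ $$=\sum_{\boldsymbol{\beta}=(1-m)\mathbf{1}}^{(m-1)\mathbf{1}}\tau_{m,\mathbf{1}+|\boldsymbol{\beta}|}\int_{\boldsymbol{\beta}/2-\mathbf{1}/2}^{\mathbf{n}-\mathbf{1}/2-\boldsymbol{\beta}/2}d\mathbf{x}\,f(\mathbf{x})=\sum_{\boldsymbol{\beta}=(1-m)\mathbf{1}}^{(m-1)\mathbf{1}}\tau_{m,\mathbf{1}+|\boldsymbol{\beta}|}\int_{-\mathbf{1}/2-\boldsymbol{\beta}/2}^{\mathbf{n}-\mathbf{1}/2-\boldsymbol{\beta}/2}d\mathbf{x}\,f(\mathbf{x})$$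 $$=\sum_{\boldsymbol{\alpha}=\mathbf{0}}^{(m-1)\mathbf{1}}\tau_{m,\mathbf{1}+\boldsymbol{\alpha}}\sum_{\boldsymbol{\beta}\colon|\boldsymbol{\beta}|=\boldsymbol{\alpha}}\int_{\boldsymbol{\beta}/2-\mathbf{1}/2}^{\mathbf{n}-\mathbf{1}/2-\boldsymbol{\beta}/2}d\mathbf{x}\,f(\mathbf{x})=\sum_{\boldsymbol{\alpha}=\mathbf{0}}^{(m-1)\mathbf{1}}\tau_{m,\mathbf{1}+\boldsymbol{\alpha}}\sum_{\boldsymbol{\beta}\colon|\boldsymbol{\beta}|=\boldsymbol{\alpha}}\int_{-\mathbf{1}/2-\boldsymbol{\beta}/2}^{\mathbf{n}-\mathbf{1}/2-\boldsymbol{\beta}/2}d\mathbf{x}\,f(\mathbf{x}),$$ and $$R_m:=\frac{m}{2^{2m+p-1}}\sum_{\|\boldsymbol{\alpha}\|=2m}\frac1{\boldsymbol{\alpha}!}\int_0^1 ds\,(1-s)^{2m-1}\int_{-\mathbf{1}}^{\mathbf{1}}d\mathbf{v}\,\mathbf{v}^{\boldsymbol{\alpha}}\sum_{\mathbf{j}=\mathbf{1}}^{m\mathbf{1}}\gamma_{m,\mathbf{j}}\,\mathbf{j}^{\boldsymbol{\alpha}+\mathbf{1}}\sum_{\mathbf{k}=\mathbf{0}}^{\mathbf{n}-\mathbf{1}}f^{(\boldsymbol{\alpha})}(\mathbf{k}+s\mathbf{j}\mathbf{v}/2).$$ The sum of all the coefficients of the integrals in each of the expressions for $A_m$ is $1$: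 $$\sum_{\mathbf{j}=\mathbf{1}}^{m\mathbf{1}}\gamma_{m,\mathbf{j}}\sum_{\mathbf{i}=\mathbf{0}}^{\mathbf{j}-\mathbf{1}}1=\sum_{\mathbf{j}=\mathbf{1}}^{m\mathbf{1}}\gamma_{m,\mathbf{j}}\,\mathbf{j}^{\mathbf{1}}=\sum_{\boldsymbol{\beta}=(1-m)\mathbf{1}}^{(m-1)\mathbf{1}}\tau_{m,\mathbf{1}+|\boldsymbol{\beta}|}=1.$$ Moreover, if $M_{2m}$ is a real number such that $$\Big|\sum_{\mathbf{k}=\mathbf{0}}^{\mathbf{n}-\mathbf{1}}f^{(\boldsymbol{\alpha})}(\mathbf{k}+\mathbf{u})\Big|\le M_{2m}\quad\text{for all }\boldsymbol{\alpha}\in\mathbb{Z}_+^p\text{ with }\|\boldsymbol{\alpha}\|=2m\text{ and all }\mathbf{u}\in(-m\mathbf{1}/2,\,m\mathbf{1}/2],$$ then $$|R_m|\le\frac{M_{2m}}{2^{2m}}\sum_{\|\boldsymbol{\alpha}\|=2m}\frac1{(\boldsymbol{\alpha}+\mathbf{1})!}\sum_{\mathbf{j}=\mathbf{1}}^{m\mathbf{1}}|\gamma_{m,\mathbf{j}}|\,\mathbf{j}^{\boldsymbol{\alpha}+\mathbf{1}}\le M_{2m}\,\frac{1.0331\,(\pi m)^{(p+1)/2}}{(2m+1)!}\,(\kappa pm)^{2m},$$ where $$\kappa:=\sqrt{\Lambda_*/4}=0.27754\dots,\qquad \Lambda_*:=\max_{0<t<1}\Lambda(t)=0.3081\dots,\qquad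 \Lambda(t):=(1-t)^{t-1}(1+t)^{-1-t}t^2.$$ If $m\ge2$, then the factor $1.0331$ in the last bound can be replaced by $1.001$.
   Context: Notation. $\mathbb{Z}_+:=\mathbb{Z}\cap[0,\infty)$. Boldface letters denote vectors with $p$ coordinates, the coordinates being denoted by the corresponding non-bold letters with indices. $\mathbf{1}:=(1,\dots,1)$, $\mathbf{0}:=(0,\dots,0)$. For $\boldsymbol{\alpha}\in\mathbb{Z}_+^p$: $\|\boldsymbol{\alpha}\|:=\alpha_1+\dots+\alpha_p$, $\boldsymbol{\alpha}!:=\alpha_1!\cdots\alpha_p!$, $\mathbf{x}^{\boldsymbol{\alpha}}:=x_1^{\alpha_1}\cdots x_p^{\alpha_p}$, and $f^{(\boldsymbol{\alpha})}$ is the corresponding partial derivative of $f$. $|\boldsymbol{\beta}|:=(|\beta_1|,\dots,|\beta_p|)$ for $\boldsymbol{\beta}\in\mathbb{Z}^p$. The product $\mathbf{j}\mathbf{v}:=(j_1v_1,\dots,j_pv_p)$ is coordinatewise, and $\mathbf{i}\le\mathbf{j}$ means $i_r\le j_r$ for all $r$. $\sum_{\mathbf{i}=\mathbf{a}}^{\mathbf{b}}$ is the sum over all integer vectors $\mathbf{i}\in\mathbb{Z}^p$ with $\mathbf{a}\le\mathbf{i}\le\mathbf{b}$ (an empty sum is $0$); $\sum_{\boldsymbol{\beta}\colon|\boldsymbol{\beta}|=\boldsymbol{\alpha}}$ is over $\boldsymbol{\beta}\in\mathbb{Z}^p$, and $\sum_{\|\boldsymbol{\alpha}\|=2m}$ is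 over $\boldsymbol{\alpha}\in\mathbb{Z}_+^p$. $(\mathbf{u},\mathbf{v}]:=\prod_{r=1}^p(u_r,v_r]$ and $[\mathbf{u},\mathbf{v}]:=\prod_{r=1}^p[u_r,v_r]$. Integrals are oriented: for $\mathbf{u},\mathbf{v}\in\mathbb{R}^p$, $$\int_{\mathbf{u}}^{\mathbf{v}}d\mathbf{x}\,h(\mathbf{x}):=(-1)^{\#\{r\colon u_r>v_r\}}\int_{\prod_{r=1}^p[\min(u_r,v_r),\max(u_r,v_r)]}h(\mathbf{x})\,d\mathbf{x}.$$ Coefficients: for integers $j\ge1$, $$\gamma_{m,j}:=(-1)^{j-1}\frac2j\binom{2m}{m+j}\Big/\binom{2m}{m},\qquad \tau_{m,j}:=\sum_{\beta=0}^{\lfloor m/2-j/2\rfloor}\gamma_{m,j+2\beta}=\sum_{\beta=0}^{\infty}\gamma_{m,j+2\beta}$$ (with $\binom{2m}{m+j}=0$ for $j>m$), and for $\mathbf{j}\in\mathbb{Z}_+^p$ with $\mathbf{j}\ge\mathbf{1}$, $\gamma_{m,\mathbf{j}}:=\prod_{r=1}^p\gamma_{m,j_r}$ and $\tau_{m,\mathbf{j}}:=\prod_{r=1}^p\tau_{m,j_r}$. *)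

theory Defs
  imports "HOL-Analysis.Analysis" "HOL-Library.Multiset"
begin

text \<open>Vectors with \<open>p\<close> coordinates are elements of \<open>'a ^ 'p\<close> with \<open>p = CARD('p)\<close>. On this type
  \<open>\<le>\<close>, \<open>+\<close>, \<open>-\<close>, \<open>*\<close>, \<open>0\<close>, \<open>1\<close> are all coordinatewise, so for integer vectors \<open>{a..b}\<close> is the
  summation range of \<open>\<Sum>\<^sub>i\<^sub>=\<^sub>a\<^sup>b\<close>, and \<open>j * v\<close> is the coordinatewise product.\<close>

definition rvec :: "int ^ 'p \<Rightarrow> real ^ 'p" where
  "rvec i = (\<chi> r. real_of_int (i $ r))"

text \<open>The library's \<open>abs\<close> on vectors is not available for integer coordinates.\<close>

definition vabs :: "int ^ 'p \<Rightarrow> int ^ 'p" where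
  "vabs b = (\<chi> r. \<bar>b $ r\<bar>)"


subsection \<open>Multi-indices and partial derivatives\<close>

definition msize :: "nat ^ 'p \<Rightarrow> nat" where
  "msize a = (\<Sum>r\<in>UNIV. a $ r)"

definition mfact :: "nat ^ 'p \<Rightarrow> real" where
  "mfact a = (\<Prod>r\<in>UNIV. fact (a $ r))"

definition mpow :: "real ^ 'p \<Rightarrow> nat ^ 'p \<Rightarrow> real" where
  "mpow x a = (\<Prod>r\<in>UNIV. (x $ r) ^ (a $ r))"

definition partial :: "'p \<Rightarrow> (real ^ 'p \<Rightarrow> real) \<Rightarrow> real ^ 'p \<Rightarrow> real" where
  "partial r f x = deriv (\<lambda>t. f (x + t *\<^sub>R axis r 1)) 0"

primrec cont_diff :: "nat \<Rightarrow> (real ^ 'p \<Rightarrow> real) \<Rightarrow> bool" where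
  "cont_diff 0 f \<longleftrightarrow> continuous_on UNIV f"
| "cont_diff (Suc k) f \<longleftrightarrow> (\<forall>x. f differentiable (at x)) \<and> (\<forall>r. cont_diff k (partial r f))"

text \<open>\<open>f\<^sup>(\<^sup>a\<^sup>)\<close> is obtained by differentiating \<open>a $ r\<close> times in each direction \<open>r\<close>. The index type carries
  no order, so the order of the differentiations is a chosen one; it does not matter if \<open>f\<close> is
  \<open>msize a\<close> times continuously differentiable (lemma \<open>mderiv_eq\<close> below).\<close>

definition mderiv :: "nat ^ 'p \<Rightarrow> (real ^ 'p \<Rightarrow> real) \<Rightarrow> real ^ 'p \<Rightarrow> real" where
  "mderiv a f = foldr partial (SOME rs. \<forall>r. count_list rs r = a $ r) f"

lemma has_partial:
  fixes f :: "real ^ 'p \<Rightarrow> real"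
  assumes "f differentiable (at (x + t *\<^sub>R axis r 1))"
  shows "((\<lambda>t. f (x + t *\<^sub>R axis r 1)) has_real_derivative partial r f (x + t *\<^sub>R axis r 1)) (at t)"
proof -
  let ?e = "axis r 1 :: real ^ 'p"
  obtain f' where f': "(f has_derivative f') (at (x + t *\<^sub>R ?e))"
    using assms by (auto simp: differentiable_def)
  have lin: "f' (c *\<^sub>R ?e) = c * f' ?e" for c
    using has_derivative_bounded_linear[OF f'] by (simp add: linear_simps)
  have line: "((\<lambda>t. y + t *\<^sub>R ?e) has_derivative (\<lambda>c. c *\<^sub>R ?e)) (at u)" for y u
    by (auto intro!: derivative_eq_intros)
  have 1: "((\<lambda>t. f (x + t *\<^sub>R ?e)) has_real_derivative f' ?e) (at t)"
    unfolding has_field_derivative_def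
    using has_derivative_compose[OF line f'] by (simp add: lin mult_commute_abs)
  have f0: "(f has_derivative f') (at (x + t *\<^sub>R ?e + 0 *\<^sub>R ?e))" using f' by simp
  have "((\<lambda>u. f (x + t *\<^sub>R ?e + u *\<^sub>R ?e)) has_real_derivative f' ?e) (at 0)"
    unfolding has_field_derivative_def
    using has_derivative_compose[OF line f0] by (simp add: lin mult_commute_abs)
  then have "partial r f (x + t *\<^sub>R ?e) = f' ?e"
    unfolding partial_def by (rule DERIV_imp_deriv)
  with 1 show ?thesis by simp
qed

lemma second_difference:
  fixes f :: "real ^ 'p \<Rightarrow> real"
  assumes "\<And>x. f differentiable (at x)" "\<And>x. partial r f differentiable (at x)" "h > 0"
  obtains a b where "0 < a" "a < h" "0 < b" "b < h"
    "f (x + h *\<^sub>R axis r 1 + h *\<^sub>R axis s 1) - f (x + h *\<^sub>R axis r 1) - f (x + h *\<^sub>R axis s 1) + f x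
      = h * h * partial s (partial r f) (x + a *\<^sub>R axis r 1 + b *\<^sub>R axis s 1)"
proof -
  let ?r = "axis r 1 :: real ^ 'p" and ?s = "axis s 1 :: real ^ 'p"
  define g where "g t = f (x + h *\<^sub>R ?s + t *\<^sub>R ?r) - f (x + t *\<^sub>R ?r)" for t
  have "(g has_real_derivative partial r f (x + h *\<^sub>R ?s + t *\<^sub>R ?r) - partial r f (x + t *\<^sub>R ?r)) (at t)" for t
    unfolding g_def by (intro DERIV_diff has_partial assms)
  then obtain a where a: "0 < a" "a < h"
    "g h - g 0 = (h - 0) * (partial r f (x + h *\<^sub>R ?s + a *\<^sub>R ?r) - partial r f (x + a *\<^sub>R ?r))"
    using MVT2[OF \<open>h > 0\<close>, of g "\<lambda>t. partial r f (x + h *\<^sub>R ?s + t *\<^sub>R ?r) - partial r f (x + t *\<^sub>R ?r)"]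
    by auto
  have "((\<lambda>t. partial r f (x + a *\<^sub>R ?r + t *\<^sub>R ?s)) has_real_derivative
          partial s (partial r f) (x + a *\<^sub>R ?r + t *\<^sub>R ?s)) (at t)" for t
    by (intro has_partial assms)
  then obtain b where b: "0 < b" "b < h"
    "partial r f (x + a *\<^sub>R ?r + h *\<^sub>R ?s) - partial r f (x + a *\<^sub>R ?r + 0 *\<^sub>R ?s)
      = (h - 0) * partial s (partial r f) (x + a *\<^sub>R ?r + b *\<^sub>R ?s)"
    using MVT2[OF \<open>h > 0\<close>, of "\<lambda>t. partial r f (x + a *\<^sub>R ?r + t *\<^sub>R ?s)"
      "\<lambda>t. partial s (partial r f) (x + a *\<^sub>R ?r + t *\<^sub>R ?s)"] by auto
  show thesis
  proof (rule that[OF a(1,2) b(1,2)])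
    have "f (x + h *\<^sub>R ?r + h *\<^sub>R ?s) - f (x + h *\<^sub>R ?r) - f (x + h *\<^sub>R ?s) + f x = g h - g 0"
      by (simp add: g_def ac_simps)
    also have "\<dots> = h * (partial r f (x + a *\<^sub>R ?r + h *\<^sub>R ?s) - partial r f (x + a *\<^sub>R ?r + 0 *\<^sub>R ?s))"
      unfolding a(3) by (simp add: ac_simps)
    also have "\<dots> = h * h * partial s (partial r f) (x + a *\<^sub>R ?r + b *\<^sub>R ?s)"
      unfolding b(3) by simp
    finally show "f (x + h *\<^sub>R ?r + h *\<^sub>R ?s) - f (x + h *\<^sub>R ?r) - f (x + h *\<^sub>R ?s) + f x
      = h * h * partial s (partial r f) (x + a *\<^sub>R ?r + b *\<^sub>R ?s)" .
  qed
qed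

lemma cont_diff_Suc: "cont_diff (Suc k) f \<Longrightarrow> cont_diff k f"
proof (induction k arbitrary: f)
  case 0
  then show ?case
    by (auto intro!: continuous_at_imp_continuous_on differentiable_imp_continuous_within)
qed auto

lemma partial_commute:
  fixes f :: "real ^ 'p \<Rightarrow> real"
  assumes "cont_diff (Suc (Suc k)) f"
  shows "partial s (partial r f) = partial r (partial s f)"
proof (rule ext, rule ccontr)
  fix x
  let ?F = "partial s (partial r f)" and ?G = "partial r (partial s f)"
  assume ne: "?F x \<noteq> ?G x"
  have cd: "cont_diff k ?F" "cont_diff k ?G" using assms by auto
  have cont: "cont_diff k g \<Longrightarrow> continuous_on UNIV g" for g
    by (induction k) (use cont_diff_Suc in auto)
  have d: "\<And>x. f differentiable (at x)" "\<And>r x. partial r f differentiable (at x)"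
    using assms by auto
  define e where "e = \<bar>?F x - ?G x\<bar> / 2"
  have "e > 0" using ne by (simp add: e_def)
  obtain d1 where d1: "d1 > 0" "\<And>y. dist y x < d1 \<Longrightarrow> dist (?F y) (?F x) < e"
    using cont[OF cd(1)] \<open>e > 0\<close> unfolding continuous_on_iff by (metis UNIV_I)
  obtain d2 where d2: "d2 > 0" "\<And>y. dist y x < d2 \<Longrightarrow> dist (?G y) (?G x) < e"
    using cont[OF cd(2)] \<open>e > 0\<close> unfolding continuous_on_iff by (metis UNIV_I)
  define h where "h = min d1 d2 / 2"
  have h: "h > 0" "2 * h \<le> d1" "2 * h \<le> d2" using d1(1) d2(1) by (auto simp: h_def)
  have near: "dist (x + a *\<^sub>R axis i 1 + b *\<^sub>R axis j 1) x < 2 * h"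
    if "0 < a" "a < h" "0 < b" "b < h" for a b i j
  proof -
    have "dist (x + a *\<^sub>R axis i 1 + b *\<^sub>R axis j 1) x = norm (a *\<^sub>R axis i (1::real) + b *\<^sub>R axis j 1)"
      by (simp add: dist_norm add.assoc)
    also have "\<dots> \<le> norm (a *\<^sub>R axis i (1::real)) + norm (b *\<^sub>R axis j (1::real))"
      by (rule norm_triangle_ineq)
    also have "\<dots> < 2 * h" using that by (simp add: norm_axis_1)
    finally show ?thesis .
  qed
  obtain a b where ab: "0 < a" "a < h" "0 < b" "b < h"
    "f (x + h *\<^sub>R axis r 1 + h *\<^sub>R axis s 1) - f (x + h *\<^sub>R axis r 1) - f (x + h *\<^sub>R axis s 1) + f x
      = h * h * ?F (x + a *\<^sub>R axis r 1 + b *\<^sub>R axis s 1)"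
    by (rule second_difference[where f = f and r = r and s = s and x = x, OF d(1) d(2) h(1)]) (rule that)
  obtain a' b' where ab': "0 < a'" "a' < h" "0 < b'" "b' < h"
    "f (x + h *\<^sub>R axis s 1 + h *\<^sub>R axis r 1) - f (x + h *\<^sub>R axis s 1) - f (x + h *\<^sub>R axis r 1) + f x
      = h * h * ?G (x + a' *\<^sub>R axis s 1 + b' *\<^sub>R axis r 1)"
    by (rule second_difference[where f = f and r = s and s = r and x = x, OF d(1) d(2) h(1)]) (rule that)
  have "h * h * ?F (x + a *\<^sub>R axis r 1 + b *\<^sub>R axis s 1)
      = h * h * ?G (x + a' *\<^sub>R axis s 1 + b' *\<^sub>R axis r 1)"
    unfolding ab(5)[symmetric] ab'(5)[symmetric] by (simp add: ac_simps)
  then have eq: "?F (x + a *\<^sub>R axis r 1 + b *\<^sub>R axis s 1) = ?G (x + a' *\<^sub>R axis s 1 + b' *\<^sub>R axis r 1)"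
    using h(1) by simp
  have "dist (?F (x + a *\<^sub>R axis r 1 + b *\<^sub>R axis s 1)) (?F x) < e"
    using near[OF ab(1-4), of r s] h(2) by (intro d1(2)) linarith
  moreover have "dist (?G (x + a' *\<^sub>R axis s 1 + b' *\<^sub>R axis r 1)) (?G x) < e"
    using near[OF ab'(1-4), of s r] h(3) by (intro d2(2)) linarith
  ultimately show False
    unfolding eq e_def dist_real_def by (smt (verit) field_sum_of_halves)
qed

lemma cont_diff_foldr: "cont_diff (length rs + k) f \<Longrightarrow> cont_diff k (foldr partial rs f)"
proof (induction rs arbitrary: k)
  case (Cons r rs)
  then have "cont_diff (Suc k) (foldr partial rs f)" by (intro Cons.IH) simp
  then show ?case by simp
qed simp

lemma foldr_partial_move:
  "cont_diff (length (xs @ r # ys)) f \<Longrightarrow>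
    foldr partial (xs @ r # ys) f = partial r (foldr partial (xs @ ys) f)"
proof (induction xs)
  case (Cons x xs)
  have cd: "cont_diff (Suc (Suc 0)) (foldr partial (xs @ ys) f)"
    using Cons.prems by (intro cont_diff_foldr) simp
  have "cont_diff (length (xs @ r # ys)) f"
    by (rule cont_diff_Suc) (use Cons.prems in simp)
  from Cons.IH[OF this] show ?case
    using partial_commute[OF cd, of x r] by simp
qed simp

lemma foldr_partial_mset:
  "cont_diff (length rs) f \<Longrightarrow> mset rs = mset rs' \<Longrightarrow> foldr partial rs f = foldr partial rs' f"
proof (induction rs arbitrary: rs')
  case (Cons r rs)
  have "r \<in> set rs'" using mset_eq_setD[OF Cons.prems(2)] by auto
  then obtain xs ys where rs': "rs' = xs @ r # ys" by (meson split_list)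
  have cd: "cont_diff (length rs') f" 
    using Cons.prems(1) unfolding mset_eq_length[OF Cons.prems(2)] .
  have m: "mset rs = mset (xs @ ys)" using Cons.prems(2) unfolding rs' by simp
  have "cont_diff (length rs) f" by (rule cont_diff_Suc) (use Cons.prems(1) in simp)
  from Cons.IH[OF this m] have "foldr partial (r # rs) f = partial r (foldr partial (xs @ ys) f)"
    by (simp only: foldr.simps o_apply)
  also have "\<dots> = foldr partial rs' f"
    unfolding rs' by (rule foldr_partial_move[symmetric]) (use cd rs' in blast)
  finally show ?case .
qed simp

lemma mderiv_eq:
  fixes a :: "nat ^ 'p"
  assumes rs: "\<forall>r. count_list rs r = a $ r" and cd: "cont_diff (msize a) f"
  shows "mderiv a f = foldr partial rs f"
proof -
  define rs' where "rs' = (SOME rs. \<forall>r. count_list rs r = a $ r)"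
  have rs': "\<forall>r. count_list rs' r = a $ r" unfolding rs'_def by (rule someI[of _ rs]) (rule rs)
  have "mset rs' = mset rs"
    by (rule multiset_eqI) (use rs rs' in \<open>simp add: count_mset\<close>)
  moreover have "length rs' = msize a"
    unfolding msize_def using rs' sum_count_set[of rs' UNIV] by simp
  ultimately show ?thesis
    unfolding mderiv_def rs'_def[symmetric] using cd by (intro foldr_partial_mset) simp_all
qed

lemma mderiv_witness: "\<exists>rs. \<forall>r. count_list rs r = (a :: nat ^ 'p) $ r"
proof -
  obtain rs where "mset rs = Abs_multiset (\<lambda>r. a $ r)" using ex_mset by blast
  then have "count (mset rs) r = a $ r" for r by simp
  then show ?thesis by (auto simp: count_mset)
qed


subsection \<open>Oriented integrals\<close>

definition oint :: "real ^ 'p \<Rightarrow> real ^ 'p \<Rightarrow> (real ^ 'p \<Rightarrow> real) \<Rightarrow> real" where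
  "oint u v h = (- 1) ^ card {r. u $ r > v $ r} *
     integral (cbox (\<chi> r. min (u $ r) (v $ r)) (\<chi> r. max (u $ r) (v $ r))) h"


subsection \<open>Coefficients\<close>

definition gam :: "nat \<Rightarrow> nat \<Rightarrow> real" where
  "gam m j = (- 1) ^ (j - 1) * (2 / real j) * real ((2 * m) choose (m + j)) / real ((2 * m) choose m)"

definition tau :: "nat \<Rightarrow> nat \<Rightarrow> real" where
  "tau m j = (\<Sum>b\<in>{0..\<lfloor>real m / 2 - real j / 2\<rfloor>}. gam m (j + 2 * nat b))"

text \<open>The vector versions are only meant for vectors \<open>\<ge> 1\<close>, where \<open>nat\<close> is harmless.\<close>

definition gamv :: "nat \<Rightarrow> int ^ 'p \<Rightarrow> real" where
  "gamv m j = (\<Prod>r\<in>UNIV. gam m (nat (j $ r)))"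

definition tauv :: "nat \<Rightarrow> int ^ 'p \<Rightarrow> real" where
  "tauv m j = (\<Prod>r\<in>UNIV. tau m (nat (j $ r)))"


subsection \<open>The approximation, the remainder and the constants\<close>

definition Am :: "nat \<Rightarrow> int ^ 'p \<Rightarrow> (real ^ 'p \<Rightarrow> real) \<Rightarrow> real" where
  "Am m n f = (\<Sum>j\<in>{1..vec (int m)}. gamv m j *
     (\<Sum>i\<in>{0..j - 1}. oint (rvec i - rvec j /\<^sub>R 2) (rvec n - 1 + rvec j /\<^sub>R 2 - rvec i) f))"

definition Rm :: "nat \<Rightarrow> int ^ 'p \<Rightarrow> (real ^ 'p \<Rightarrow> real) \<Rightarrow> real" where
  "Rm m n f = real m / 2 ^ (2 * m + CARD('p) - 1) *
     (\<Sum>a\<in>{a. msize a = 2 * m}. 1 / mfact a *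
       integral {0..1::real} (\<lambda>s. (1 - s) ^ (2 * m - 1) *
         oint (- 1) 1 (\<lambda>v. mpow v a *
           (\<Sum>j\<in>{1..vec (int m)}. gamv m j * mpow (rvec j) (a + 1) *
             (\<Sum>k\<in>{0..n - 1}. mderiv a f (rvec k + s *\<^sub>R (rvec j * v) /\<^sub>R 2))))))"

definition Lambda :: "real \<Rightarrow> real" where
  "Lambda t = (1 - t) powr (t - 1) * (1 + t) powr (- 1 - t) * t ^ 2"

text \<open>That this supremum is a maximum is part of the theorem.\<close>

definition Lambda_star :: real where
  "Lambda_star = (SUP t\<in>{0<..<1}. Lambda t)"

definition kappa :: real where
  "kappa = sqrt (Lambda_star / 4)"

end

theory Submission
  imports Defs "HOL-Combinatorics.Multiset_Permutations"
begin

text \<open> The coefficients \<open>gam m j\<close> come from the fact that a finite difference of order \<open>2m\<close>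
  annihilates polynomials of lower degree: \<open>\<Sum>j. gam m j * j ^ (2 * q + 1)\<close> is \<open>1\<close> for \<open>q = 0\<close> and
  \<open>0\<close> for \<open>0 < q < m\<close> (\<open>gam_moments\<close>). Integrate \<open>f\<close> over the box with centre \<open>k\<close> and side lengths
  \<open>j $ r\<close>, and sum over \<open>j\<close> with weights \<open>gamv m j\<close>. In the Taylor expansion of \<open>f\<close> at \<open>k\<close> the
  monomials with an odd exponent integrate to zero, and the remaining ones of degree between \<open>1\<close> and
  \<open>2m - 1\<close> are annihilated by the weights in some coordinate (\<open>moment_cancellation\<close>). Hence the
  weighted sum is \<open>f k\<close> plus the integrated Taylor remainder, and summing over \<open>k\<close> gives the formula
  (\<open>sum_eq_Am_minus_Rm\<close>).

  The various forms of the approximation agree because all of them integrate \<open>f\<close> against the same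
  step function. An oriented integral is the integral against a product of signed indicators of
  intervals, one for each coordinate (\<open>oint_has_integral\<close>). Since coefficients and summation ranges
  are products as well, so are the total weights, and it remains to compare step functions of one
  variable: overlapping windows of length \<open>j\<close> telescope to long intervals
  (\<open>signed_indicator_window_sum\<close>), reversal of the order of summation moves the lower ends
  (\<open>signed_indicator_reflect_sum\<close>), and grouping by the position of the end points turns \<open>gam\<close> into
  \<open>tau\<close> (\<open>sum_gam_tau\<close>).

  The first bound on the remainder is the triangle inequality (\<open>Rm_bound\<close>). For the second, the sum
  over multi-indices is the integral of a power of a linear form over the unit cube, by the
  multinomial theorem, and the power mean inequality separates the coordinates
  (\<open>sum_multi_index_le\<close>, \<open>abs_bound_by_moments\<close>). This leaves two sums over \<open>j = 1..m\<close>. The first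
  one is \<open>4 ^ m / (2 * m choose m) - 1\<close>, which Wallis's product bounds by \<open>sqrt (pi * m)\<close>. The
  second one is twice the sum of \<open>(2 * m choose (m + j)) * j ^ (2 * m)\<close>, divided by the central
  binomial coefficient. Its terms are of the order of \<open>Lambda (j / m) ^ m\<close> up to the normalisation,
  and replacing \<open>j / m\<close> by an exponential tangent at the maximiser of \<open>Lambda\<close> sums it with the
  exact exponential rate \<open>Lambda_star ^ m\<close> (\<open>exponential_majorant_sum\<close>). For \<open>m \<ge> 2\<close> the factor that
  is left is at most \<open>pi * m\<close> (\<open>abs_moment_top_le\<close>). For \<open>m = 1\<close> the second sum is \<open>1\<close>, and the
  constant \<open>1.0331\<close> is barely large enough, so that \<open>Lambda_star\<close> must be known to five digits
  (\<open>Lambda_star_bounds\<close>). \<close>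

section \<open>Sums over boxes of integer vectors\<close>

lemma mem_box_int_vec:
  fixes j :: "int ^ 'p"
  shows "j \<in> {a..b} \<longleftrightarrow> (\<forall>r. j $ r \<in> {a $ r..b $ r})"
  by (auto simp: less_eq_vec_def)

lemma bij_betw_vec_PiE:
  fixes S :: "'p::finite \<Rightarrow> 'a set"
  shows "bij_betw vec_nth {j. \<forall>r. j $ r \<in> S r} (PiE UNIV S)"
  by (rule bij_betw_byWitness[where f' = vec_lambda]) (auto simp: PiE_def Pi_def)

lemma sum_vec_prod:
  fixes g :: "'p::finite \<Rightarrow> 'a \<Rightarrow> 'b::comm_semiring_1"
  assumes "\<And>r. finite (S r)"
  shows "(\<Sum>j\<in>{j. \<forall>r. j $ r \<in> S r}. \<Prod>r\<in>UNIV. g r (j $ r)) = (\<Prod>r\<in>UNIV. \<Sum>x\<in>S r. g r x)"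
proof -
  have "(\<Prod>r\<in>UNIV. \<Sum>x\<in>S r. g r x) = (\<Sum>h\<in>PiE UNIV S. \<Prod>r\<in>UNIV. g r (h r))"
    using assms by (intro prod_sum_PiE) auto
  also have "\<dots> = (\<Sum>j\<in>{j. \<forall>r. j $ r \<in> S r}. \<Prod>r\<in>UNIV. g r (j $ r))"
    by (rule sum.reindex_bij_betw[OF bij_betw_vec_PiE, symmetric])
  finally show ?thesis ..
qed

text \<open>Every coefficient in the theorem is a product over the coordinates and every summation range
  is a box, so this lemma is what reduces multidimensional sums of coefficients to sums over
  integers.\<close>

lemma sum_box_prod:
  fixes g :: "'p::finite \<Rightarrow> int \<Rightarrow> 'b::comm_semiring_1"
  shows "(\<Sum>j\<in>{a..b}. \<Prod>r\<in>UNIV. g r (j $ r)) = (\<Prod>r\<in>UNIV. \<Sum>x\<in>{a $ r..b $ r}. g r x)"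
  using sum_vec_prod[where S = "\<lambda>r. {a $ r..b $ r}" and g = g]
  by (simp add: mem_box_int_vec[symmetric] del: atLeastAtMost_iff)

lemma finite_box_int_vec: "finite {a..b :: int ^ 'p}"
proof -
  have "finite (PiE UNIV (\<lambda>r. {a $ r..b $ r}))" by (intro finite_PiE) auto
  then have "finite {j. \<forall>r. j $ r \<in> {a $ r..b $ r}}"
    using bij_betw_finite[OF bij_betw_vec_PiE[of "\<lambda>r. {a $ r..b $ r}"]] by blast
  then show ?thesis by (simp add: mem_box_int_vec[symmetric] del: atLeastAtMost_iff)
qed

section \<open>Moments of the coefficients\<close>

text \<open>The sum is, up to sign, the \<open>n\<close>-th finite difference of a polynomial of degree \<open>d < n\<close>.
  Pascal's rule turns it into an \<open>(n - 1)\<close>-st difference of \<open>(x + 1) ^ d - x ^ d\<close>, which has degree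
  below \<open>d\<close>; since that polynomial is expanded in powers of \<open>k + c\<close>, the induction runs over all \<open>d\<close>
  and \<open>c\<close> at once.\<close>

lemma alternating_binomial_power_sum:
  fixes c :: "'a::comm_ring_1"
  shows "d < n \<Longrightarrow> (\<Sum>k\<le>n. (-1) ^ k * of_nat (n choose k) * (of_nat k + c) ^ d) = 0"
proof (induction n arbitrary: d c)
  case (Suc n)
  define g where "g k = (of_nat k + c) ^ d" for k
  have "(\<Sum>k\<le>Suc n. (-1) ^ k * of_nat (Suc n choose k) * g k)
      = g 0 - (\<Sum>k\<le>n. (-1) ^ k * of_nat (Suc n choose Suc k) * g (Suc k))"
    by (subst sum.atMost_Suc_shift) (simp add: sum_negf)
  also have "\<dots> = g 0 - (\<Sum>k\<le>n. (-1) ^ k * of_nat (n choose Suc k) * g (Suc k))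
      - (\<Sum>k\<le>n. (-1) ^ k * of_nat (n choose k) * g (Suc k))"
    by (simp add: algebra_simps sum.distrib)
  also have "g 0 - (\<Sum>k\<le>n. (-1) ^ k * of_nat (n choose Suc k) * g (Suc k))
      = (\<Sum>k\<le>Suc n. (-1) ^ k * of_nat (n choose k) * g k)"
    by (subst sum.atMost_Suc_shift) (simp add: sum_negf)
  also have "\<dots> = (\<Sum>k\<le>n. (-1) ^ k * of_nat (n choose k) * g k)" by (simp add: binomial_eq_0)
  also have "\<dots> - (\<Sum>k\<le>n. (-1) ^ k * of_nat (n choose k) * g (Suc k))
      = - (\<Sum>k\<le>n. (-1) ^ k * of_nat (n choose k) * (g (Suc k) - g k))"
    by (simp add: algebra_simps sum_subtractf)
  also have "\<dots> = - (\<Sum>k\<le>n. \<Sum>i<d. of_nat (d choose i)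
      * ((-1) ^ k * of_nat (n choose k) * (of_nat k + c) ^ i))"
  proof -
    have "g (Suc k) - g k = (\<Sum>i<d. of_nat (d choose i) * (of_nat k + c) ^ i)" for k
    proof -
      have "g (Suc k) = ((of_nat k + c) + 1) ^ d" by (simp add: g_def algebra_simps)
      also have "\<dots> = (\<Sum>i\<le>d. of_nat (d choose i) * (of_nat k + c) ^ i)"
        by (subst binomial_ring) simp
      also have "{..d} = insert d {..<d}" by auto
      finally show ?thesis by (simp add: g_def)
    qed
    then show ?thesis by (simp add: sum_distrib_left mult_ac)
  qed
  also have "\<dots> = - (\<Sum>i<d. of_nat (d choose i)
      * (\<Sum>k\<le>n. (-1) ^ k * of_nat (n choose k) * (of_nat k + c) ^ i))"
    by (subst sum.swap) (simp add: sum_distrib_left)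
  also have "\<dots> = 0" using Suc.prems by (simp add: Suc.IH)
  finally show ?case unfolding g_def .
qed simp

lemma sum_symmetric_atMost:
  fixes h :: "nat \<Rightarrow> real"
  assumes "\<And>j. j \<in> {1..m} \<Longrightarrow> h (m - j) = h (m + j)"
  shows "(\<Sum>k\<le>2 * m. h k) = h m + 2 * (\<Sum>j=1..m. h (m + j))"
proof -
  have split: "{..2 * m} = {..<m} \<union> {m} \<union> {m<..2 * m}" by auto
  have "(\<Sum>k\<in>{m<..2 * m}. h k) = (\<Sum>j=1..m. h (m + j))"
    by (rule sum.reindex_bij_witness[of _ "\<lambda>j. m + j" "\<lambda>k. k - m"]) auto
  moreover have "(\<Sum>k\<in>{..<m}. h k) = (\<Sum>j=1..m. h (m - j))"
    by (rule sum.reindex_bij_witness[of _ "\<lambda>j. m - j" "\<lambda>k. m - k"]) auto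
  moreover have "(\<Sum>j=1..m. h (m - j)) = (\<Sum>j=1..m. h (m + j))" using assms by simp
  moreover have "(\<Sum>k\<le>2 * m. h k) = (\<Sum>k\<in>{..<m}. h k) + h m + (\<Sum>k\<in>{m<..2 * m}. h k)"
    unfolding split by (subst sum.union_disjoint; force)+ 
  ultimately show ?thesis by simp
qed

lemma binomial_central_symmetric:
  "j \<le> m \<Longrightarrow> (2 * m) choose (m - j) = (2 * m) choose (m + j)"
  using binomial_symmetric[of "m - j" "2 * m"] by (simp add: algebra_simps)

text \<open>The defining property of the coefficients. Centred at the middle binomial coefficient, the
  vanishing \<open>2m\<close>-th difference of \<open>x ^ (2 * q)\<close> is symmetric under \<open>j \<mapsto> - j\<close>; folding it in half
  gives the sum over \<open>j = 1..m\<close>, and the central term, which is left on the other side, is nonzero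
  only for \<open>q = 0\<close>. The odd exponent arises because \<open>gam m j\<close> carries a factor \<open>1 / j\<close>.\<close>

lemma gam_moments:
  assumes "q < m"
  shows "(\<Sum>j=1..m. gam m j * real j ^ (2 * q + 1)) = (if q = 0 then 1 else 0)"
proof -
  define h where "h k = (-1) ^ k * real ((2 * m) choose k) * (real k - real m) ^ (2 * q)" for k
  have "(\<Sum>k\<le>2 * m. h k) = 0"
    using alternating_binomial_power_sum[of "2 * q" "2 * m" "- real m"] assms by (simp add: h_def)
  moreover have "h (m - j) = h (m + j)" if "j \<in> {1..m}" for j
  proof -
    have "m + j = m - j + 2 * j" using that by auto
    then have "(-1 :: real) ^ (m + j) = (-1) ^ (m - j)" 
      by (metis power_add power_minus1_even mult.right_neutral)
    moreover have "real (m - j) - real m = - real j" "real (m + j) - real m = real j" using that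
        by auto
    moreover have "(- real j) ^ (2 * q) = real j ^ (2 * q)" by (simp add: power_mult)
    ultimately show ?thesis using that by (simp add: h_def binomial_central_symmetric)
  qed
  ultimately have "h m + 2 * (\<Sum>j=1..m. h (m + j)) = 0" using sum_symmetric_atMost[of m h] by simp
  moreover have "gam m j * real j ^ (2 * q + 1)
      = - ((-1) ^ m * 2 * h (m + j)) / real ((2 * m) choose m)"
    if "j \<in> {1..m}" for j
  proof -
    have "(-1 :: real) ^ m * (-1) ^ (m + j) = (-1) ^ j"
        by (simp add: power_add flip: mult.assoc power_mult_distrib)
    moreover have "(-1 :: real) ^ (j - 1) = - ((-1) ^ j)" using that by (cases j) auto
    ultimately have "(-1 :: real) ^ (j - 1) = - ((-1) ^ m * (-1) ^ (m + j))" by simp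
    then show ?thesis using that
      unfolding gam_def h_def by (simp add: field_simps)
  qed
  ultimately have "(\<Sum>j=1..m. gam m j * real j ^ (2 * q + 1))
      = ((-1) ^ m * h m) / real ((2 * m) choose m)"
    by (simp add: sum_negf sum_divide_distrib[symmetric] sum_distrib_left[symmetric] mult.assoc)
      (smt (verit) mult_minus_right minus_divide_left)
  also have "(-1) ^ m * h m = real ((2 * m) choose m) * 0 ^ (2 * q)"
    by (simp add: h_def flip: mult.assoc power_mult_distrib)
  finally show ?thesis by (auto simp: zero_power)
qed

text \<open>The pair \<open>(j, i)\<close> with \<open>0 \<le> i < j\<close> enters only through \<open>b = 2 * i + 1 - j\<close>. The \<open>j\<close> that
  produce a given \<open>b\<close> are \<open>1 + \<bar>b\<bar> + 2 * t\<close> with \<open>t \<ge> 0\<close>, and the sum of their coefficients is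
  \<open>tau\<close>.\<close>

lemma sum_gam_tau:
  fixes g :: "int \<Rightarrow> real"
  shows "(\<Sum>j\<in>{1..int m}. gam m (nat j) * (\<Sum>i\<in>{0..j - 1}. g (2 * i + 1 - j)))
       = (\<Sum>b\<in>{1 - int m..int m - 1}. tau m (nat (1 + \<bar>b\<bar>)) * g b)"
proof -
  have tau: "tau m (nat (1 + \<bar>b\<bar>))
      = (\<Sum>t\<in>{t. 0 \<le> t \<and> 1 + \<bar>b\<bar> + 2 * t \<le> int m}. gam m (nat (1 + \<bar>b\<bar> + 2 * t)))" for b :: int
  proof -
    have "real m / 2 - real (nat (1 + \<bar>b\<bar>)) / 2 = real_of_int (int m - (1 + \<bar>b\<bar>)) / real_of_int 2"
      by (simp add: field_simps)
    then have "\<lfloor>real m / 2 - real (nat (1 + \<bar>b\<bar>)) / 2\<rfloor> = (int m - (1 + \<bar>b\<bar>)) div 2"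
      by (simp only: floor_divide_of_int_eq)
    moreover have "t \<le> (int m - (1 + \<bar>b\<bar>)) div 2 \<longleftrightarrow> 1 + \<bar>b\<bar> + 2 * t \<le> int m" for t by auto
    moreover have "nat (1 + \<bar>b\<bar>) + 2 * nat t = nat (1 + \<bar>b\<bar> + 2 * t)" if "0 \<le> t" for t using that
        by auto
    ultimately show ?thesis unfolding tau_def by (intro sum.cong) auto
  qed
  have "(\<Sum>j\<in>{1..int m}. gam m (nat j) * (\<Sum>i\<in>{0..j - 1}. g (2 * i + 1 - j)))
     = (\<Sum>(j, i)\<in>(SIGMA j:{1..int m}. {0..j - 1}). gam m (nat j) * g (2 * i + 1 - j))"
    by (simp add: sum_distrib_left sum.Sigma)
  \<comment> \<open>Here \<open>t\<close> is half the excess of \<open>j\<close> over \<open>1 + \<bar>b\<bar>\<close>, and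
     \<open>(b + \<bar>b\<bar>) div 2\<close> is the positive part of \<open>b\<close>.\<close>
  also have "\<dots> = (\<Sum>(b, t)\<in>(SIGMA b:{1 - int m..int m - 1}. {t. 0 \<le> t \<and> 1 + \<bar>b\<bar> + 2 * t \<le> int m}).
      gam m (nat (1 + \<bar>b\<bar> + 2 * t)) * g b)"
    by (rule sum.reindex_bij_witness[of _ "\<lambda>(b, t). (1 + \<bar>b\<bar> + 2 * t, (b + \<bar>b\<bar>) div 2 + t)"
          "\<lambda>(j, i). (2 * i + 1 - j, (j - 1 - \<bar>2 * i + 1 - j\<bar>) div 2)"])
      (auto simp: abs_if split: if_splits)
  also have "\<dots> = (\<Sum>b\<in>{1 - int m..int m - 1}. tau m (nat (1 + \<bar>b\<bar>)) * g b)"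
  proof -
    have "finite {t. 0 \<le> t \<and> 1 + \<bar>b\<bar> + 2 * t \<le> int m}" for b
      by (rule finite_subset[of _ "{0..int m}"]) auto
    then show ?thesis by (subst sum.Sigma[symmetric]) (auto simp: tau sum_distrib_right)
  qed
  finally show ?thesis .
qed

lemma sum_gam_int:
  "(\<Sum>j\<in>{1..int m}. gam m (nat j) * real_of_int j ^ k) = (\<Sum>j=1..m. gam m j * real j ^ k)"
  by (rule sum.reindex_bij_witness[of _ int nat]) auto

section \<open>Oriented integrals as integrals against step functions\<close>

text \<open>The indicator of \<open>(u, v]\<close>, with sign \<open>- 1\<close> if the interval is reversed. Written as a
  difference of two half-lines it is additive in the end points whatever their order, which is what
  telescoping needs.\<close>

definition signed_indicator :: "real \<Rightarrow> real \<Rightarrow> real \<Rightarrow> real" where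
  "signed_indicator u v x = of_bool (x \<le> v) - of_bool (x \<le> u)"

text \<open>The half-open product weight differs from the closed box in the definition of \<open>oint\<close> only on
  finitely many coordinate hyperplanes, a null set. Integrating over the whole space puts all
  oriented integrals on a common domain, so that a linear identity between them follows from a
  pointwise identity between weights.\<close>

lemma oint_has_integral:
  fixes h :: "real ^ 'p \<Rightarrow> real"
  assumes h: "continuous_on UNIV h"
  shows "((\<lambda>x. (\<Prod>r\<in>UNIV. signed_indicator (u $ r) (v $ r) (x $ r)) * h x)
      has_integral oint u v h) UNIV"
proof -
  define a where "a = (\<chi> r. min (u $ r) (v $ r))"
  define b where "b = (\<chi> r. max (u $ r) (v $ r))"
  define N where "N = (\<Union>r. {x :: real ^ 'p. x $ r = a $ r})"
  define e where "e = (-1 :: real) ^ card {r. u $ r > v $ r}"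
  have N: "negligible N"
    unfolding N_def by (intro negligible_Union)
        (auto simp: cart_eq_inner_axis negligible_standard_hyperplane)
  have "continuous_on (cbox a b) h" using h continuous_on_subset by blast
  then have "(h has_integral integral (cbox a b) h) (cbox a b)"
    using integrable_continuous integrable_integral by blast
  then have restricted:
    "((\<lambda>x. e * (if x \<in> cbox a b then h x else 0)) has_integral e * integral (cbox a b) h) UNIV"
    by (intro has_integral_mult_right) (simp add: has_integral_restrict_UNIV)
  have weight: "(\<Prod>r\<in>UNIV. signed_indicator (u $ r) (v $ r) (x $ r)) * h x
      = e * (if x \<in> cbox a b then h x else 0)"
    if "x \<in> UNIV - N" for x
  proof (cases "x \<in> cbox a b")
    case True
    have "signed_indicator (u $ r) (v $ r) (x $ r) = (if u $ r > v $ r then -1 else 1)" for r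
    proof -
      have "x $ r \<noteq> a $ r" using that by (auto simp: N_def)
      moreover have "a $ r \<le> x $ r" "x $ r \<le> b $ r" using True by (auto simp: mem_box_cart)
      ultimately show ?thesis by (auto simp: a_def b_def signed_indicator_def min_def max_def split:
          if_splits)
    qed
    then have "(\<Prod>r\<in>UNIV. signed_indicator (u $ r) (v $ r) (x $ r)) = e"
      by (simp add: prod.If_cases e_def)
    with True show ?thesis by simp
  next
    case False
    then obtain r where "x $ r < a $ r \<or> x $ r > b $ r" by (auto simp: mem_box_cart not_le)
    then have "signed_indicator (u $ r) (v $ r) (x $ r) = 0"
      by (auto simp: a_def b_def signed_indicator_def)
    then have "(\<Prod>r\<in>UNIV. signed_indicator (u $ r) (v $ r) (x $ r)) = 0"
      by (intro prod_zero) auto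
    with False show ?thesis by simp
  qed
  have "((\<lambda>x. (\<Prod>r\<in>UNIV. signed_indicator (u $ r) (v $ r) (x $ r)) * h x)
      has_integral e * integral (cbox a b) h) UNIV"
    by (rule has_integral_spike[OF N weight restricted])
  then show ?thesis by (simp add: oint_def e_def a_def b_def)
qed

lemma tauv_oint_has_integral:
  fixes h :: "real ^ 'p \<Rightarrow> real"
  assumes h: "continuous_on UNIV h"
  shows "((\<lambda>x. (\<Prod>r\<in>UNIV. \<Sum>b\<in>{1 - int m..int m - 1}.
             tau m (nat (1 + \<bar>b\<bar>)) * signed_indicator (lo r b) (hi r b) (x $ r)) * h x)
      has_integral (\<Sum>b\<in>{vec (1 - int m)..vec (int m - 1)}. tauv m (1 + vabs b) *
         oint (\<chi> r. lo r (b $ r)) (\<chi> r. hi r (b $ r)) h)) UNIV"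
proof -
  have "((\<lambda>x. \<Sum>b\<in>{vec (1 - int m)..vec (int m - 1)}. tauv m (1 + vabs b) *
        ((\<Prod>r\<in>UNIV. signed_indicator (lo r (b $ r)) (hi r (b $ r)) (x $ r)) * h x))
      has_integral (\<Sum>b\<in>{vec (1 - int m)..vec (int m - 1)}. tauv m (1 + vabs b) *
         oint (\<chi> r. lo r (b $ r)) (\<chi> r. hi r (b $ r)) h)) UNIV"
    by (intro has_integral_sum finite_box_int_vec has_integral_mult_right)
      (use oint_has_integral[OF h, of "\<chi> r. lo r (b $ r)" "\<chi> r. hi r (b $ r)" for b] in simp)
  also have "(\<lambda>x. \<Sum>b\<in>{vec (1 - int m)..vec (int m - 1)}. tauv m (1 + vabs b) *
        ((\<Prod>r\<in>UNIV. signed_indicator (lo r (b $ r)) (hi r (b $ r)) (x $ r)) * h x))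
     = (\<lambda>x. (\<Sum>b\<in>{vec (1 - int m)..vec (int m - 1)}. 
        (\<Prod>r\<in>UNIV. tau m (nat (1 + \<bar>b $ r\<bar>))
            * signed_indicator (lo r (b $ r)) (hi r (b $ r)) (x $ r))) * h x)"
    by (simp add: tauv_def vabs_def prod.distrib sum_distrib_right mult.assoc)
  finally show ?thesis
    by (subst (asm) sum_box_prod[where g
        = "\<lambda>r b. tau m (nat (1 + \<bar>b\<bar>)) * signed_indicator (lo r b) (hi r b) (_ $ r)"]) simp
qed

text \<open>The upper limit \<open>e r j\<close> of the inner sum is a parameter because the lemma is used both for \<open>0
  \<le> i \<le> j - 1\<close> and for \<open>0 \<le> k \<le> n - 1\<close>.\<close>

lemma gamv_oint_has_integral:
  fixes h :: "real ^ 'p \<Rightarrow> real" and lo hi :: "'p \<Rightarrow> int \<Rightarrow> int \<Rightarrow> real" and e :: "'p \<Rightarrow> int \<Rightarrow> int"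
  assumes h: "continuous_on UNIV h"
  shows "((\<lambda>x. (\<Prod>r\<in>UNIV. \<Sum>j\<in>{1..int m}.
             gam m (nat j) * (\<Sum>i\<in>{0..e r j}. signed_indicator (lo r j i) (hi r j i) (x $ r))) * h x)
      has_integral (\<Sum>j\<in>{1..vec (int m)}. gamv m j * (\<Sum>i\<in>{0..\<chi> r. e r (j $ r)}.
         oint (\<chi> r. lo r (j $ r) (i $ r)) (\<chi> r. hi r (j $ r) (i $ r)) h))) UNIV"
proof -
  have "((\<lambda>x. \<Sum>j\<in>{1..vec (int m)}. gamv m j * (\<Sum>i\<in>{0..\<chi> r. e r (j $ r)}.
         (\<Prod>r\<in>UNIV. signed_indicator (lo r (j $ r) (i $ r)) (hi r (j $ r) (i $ r)) (x $ r)) * h x))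
      has_integral (\<Sum>j\<in>{1..vec (int m)}. gamv m j * (\<Sum>i\<in>{0..\<chi> r. e r (j $ r)}.
         oint (\<chi> r. lo r (j $ r) (i $ r)) (\<chi> r. hi r (j $ r) (i $ r)) h))) UNIV"
    by (intro has_integral_sum finite_box_int_vec has_integral_mult_right)
      (use oint_has_integral[OF h, of "\<chi> r. lo r (j $ r) (i $ r)" "\<chi> r. hi r (j $ r) (i $ r)"
          for i j]
       in \<open>simp_all add: finite_box_int_vec\<close>)
  also have "(\<lambda>x. \<Sum>j\<in>{1..vec (int m)}. gamv m j * (\<Sum>i\<in>{0..\<chi> r. e r (j $ r)}.
         (\<Prod>r\<in>UNIV. signed_indicator (lo r (j $ r) (i $ r)) (hi r (j $ r) (i $ r)) (x $ r)) * h x))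
    = (\<lambda>x. (\<Prod>r\<in>UNIV. \<Sum>j\<in>{1..int m}.
             gam m (nat j) * (\<Sum>i\<in>{0..e r j}. signed_indicator (lo r j i) (hi r j i) (x $ r)))
                * h x)"
    (is "?L = ?R")
  proof
    fix x
    have "?L x = (\<Sum>j\<in>{1..vec (int m)}. gamv m j * (\<Prod>r\<in>UNIV. \<Sum>i\<in>{0..e r (j $ r)}.
        signed_indicator (lo r (j $ r) i) (hi r (j $ r) i) (x $ r))) * h x"
      using sum_box_prod[where a = 0 and b = "\<chi> r. e r (j $ r)" and
          g = "\<lambda>r i. signed_indicator (lo r (j $ r) i) (hi r (j $ r) i) (x $ r)" for j]
      by (simp add: sum_distrib_right[symmetric] mult.assoc[symmetric])
    also have "\<dots> = (\<Sum>j\<in>{1..vec (int m)}. (\<Prod>r\<in>UNIV. gam m (nat (j $ r)) * (\<Sum>i\<in>{0..e r (j $ r)}.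
        signed_indicator (lo r (j $ r) i) (hi r (j $ r) i) (x $ r)))) * h x"
      by (simp add: gamv_def prod.distrib)
    also have "\<dots> = ?R x"
      by (subst sum_box_prod[where g = "\<lambda>r j. gam m (nat j) * (\<Sum>i\<in>{0..e r j}.
        signed_indicator (lo r j i) (hi r j i) (x $ r))"]) simp
    finally show "?L x = ?R x" .
  qed
  finally show ?thesis .
qed

section \<open>Rearrangements of step functions on the line\<close>

lemma sum_int_reverse: "(\<Sum>i\<in>{0..j - 1 :: int}. G i) = (\<Sum>i\<in>{0..j - 1}. G (j - 1 - i))"
  by (rule sum.reindex_bij_witness[of _ "\<lambda>i. j - 1 - i" "\<lambda>i. j - 1 - i"]) auto

lemma sum_shift_difference:
  fixes F :: "int \<Rightarrow> 'a::ab_group_add"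
  shows "(\<Sum>i\<in>{0..j - 1}. F (c - i)) - (\<Sum>i\<in>{0..j - 1}. F (c - 1 - i))
      = (if j \<ge> 0 then F c - F (c - j) else 0)"
proof (cases "j \<ge> 0")
  case True
  then show ?thesis
  proof (induction j rule: int_ge_induct)
    case (step j)
    have "{0..j + 1 - 1} = insert j {0..j - 1}" using step.hyps by auto
    then show ?case using step by (simp add: algebra_simps)
  qed simp
qed simp

text \<open>Each difference \<open>F k - F (k - j)\<close> is a telescoping sum of \<open>j\<close> unit steps; summing over \<open>k\<close>
  first makes the unit steps telescope along \<open>k\<close> instead. The induction on \<open>n\<close> does both at once.\<close>

lemma window_telescope:
  fixes F :: "int \<Rightarrow> 'a::ab_group_add"
  assumes "n \<ge> 0" "j \<ge> 0"
  shows "(\<Sum>k\<in>{0..n - 1}. F k - F (k - j)) = (\<Sum>i\<in>{0..j - 1}. F (n - 1 - i) - F (- 1 - i))"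
  using assms(1)
proof (induction n rule: int_ge_induct)
  case (step n)
  have "{0..n + 1 - 1} = insert n {0..n - 1}" using step.hyps by auto
  then show ?case using step sum_shift_difference[of F n j] assms(2)
    by (simp add: sum_subtractf algebra_simps)
qed simp

text \<open>Reversing the order of summation replaces the lower end \<open>i - j / 2\<close> by \<open>j - 1 - i - j / 2\<close>.
  The upper ends \<open>v i\<close> are unaffected because the weight splits into an upper and a lower part.\<close>

lemma signed_indicator_reflect_sum:
  "(\<Sum>i\<in>{0..j - 1}. signed_indicator (real_of_int i - real_of_int j / 2) (v i) x)
   = (\<Sum>i\<in>{0..j - 1}. signed_indicator (- 1 + real_of_int j / 2 - real_of_int i) (v i) x)"
  unfolding signed_indicator_def sum_subtractf
  by (subst (2) sum_int_reverse) (simp add: algebra_simps field_simps)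

text \<open>The windows of length \<open>j\<close> centred at \<open>0, \<dots>, n - 1\<close> overlap; this regroups them into \<open>j\<close> long
  intervals, and thereby removes the sum over \<open>k\<close> from the approximation.\<close>

lemma signed_indicator_window_sum:
  assumes "n \<ge> 0" "j \<ge> 0"
  shows "(\<Sum>k\<in>{0..n - 1}. signed_indicator (real_of_int k - real_of_int j / 2)
      (real_of_int k + real_of_int j / 2) x)
   = (\<Sum>i\<in>{0..j - 1}. signed_indicator (real_of_int i - real_of_int j / 2)
       (real_of_int n - 1 + real_of_int j / 2 - real_of_int i) x)"
  unfolding signed_indicator_reflect_sum
  using window_telescope[OF assms, of "\<lambda>k. of_bool (x \<le> real_of_int k + real_of_int j / 2) :: real"]
  by (simp add: signed_indicator_def algebra_simps)

section \<open>The expressions for the approximation\<close>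

lemma prod_tau_weight_eq:
  "(\<Prod>r\<in>UNIV. \<Sum>b\<in>{1 - int m..int m - 1}. tau m (nat (1 + \<bar>b\<bar>)) * g r b)
   = (\<Prod>r\<in>UNIV. \<Sum>j\<in>{1..int m}. gam m (nat j) * (\<Sum>i\<in>{0..j - 1}. g r (2 * i + 1 - j)))"
  by (simp add: sum_gam_tau)

context
  fixes f :: "real ^ 'p \<Rightarrow> real" and n :: "int ^ 'p" and m :: nat
  assumes f: "continuous_on UNIV f"
begin

lemma Am_has_integral:
  "((\<lambda>x. (\<Prod>r\<in>UNIV. \<Sum>j\<in>{1..int m}. gam m (nat j)
      * (\<Sum>i\<in>{0..j - 1}. signed_indicator (real_of_int i - real_of_int j / 2)
       (real_of_int (n $ r) - 1 + real_of_int j / 2 - real_of_int i) (x $ r))) * f x)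
           has_integral Am m n f) UNIV"
proof -
  have "rvec i - rvec j /\<^sub>R 2 = (\<chi> r. real_of_int (i $ r) - real_of_int (j $ r) / 2)"
    "rvec n - 1 + rvec j /\<^sub>R 2 - rvec i
        = (\<chi> r. real_of_int (n $ r) - 1 + real_of_int (j $ r) / 2 - real_of_int (i $ r))"
    "j - 1 = (\<chi> r. j $ r - 1)" for i j :: "int ^ 'p"
    by (simp_all add: vec_eq_iff rvec_def)
  then show ?thesis
    using gamv_oint_has_integral[OF f, where e = "\<lambda>r j. j - 1" and m = m and 
      lo = "\<lambda>r j i. real_of_int i - real_of_int j / 2" and
      hi = "\<lambda>r j i. real_of_int (n $ r) - 1 + real_of_int j / 2 - real_of_int i"]
    unfolding Am_def by simp
qed

lemma Am_eq_shifted: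
  "Am m n f = (\<Sum>j\<in>{1..vec (int m)}. gamv m j *
     (\<Sum>i\<in>{0..j - 1}. oint (- 1 + rvec j /\<^sub>R 2 - rvec i) (rvec n - 1 + rvec j /\<^sub>R 2 - rvec i) f))"
proof -
  have "- 1 + rvec j /\<^sub>R 2 - rvec i = (\<chi> r. - 1 + real_of_int (j $ r) / 2 - real_of_int (i $ r))"
    "rvec n - 1 + rvec j /\<^sub>R 2 - rvec i
        = (\<chi> r. real_of_int (n $ r) - 1 + real_of_int (j $ r) / 2 - real_of_int (i $ r))"
    "j - 1 = (\<chi> r. j $ r - 1)" for i j :: "int ^ 'p"
    by (simp_all add: vec_eq_iff rvec_def)
  then show ?thesis
    using gamv_oint_has_integral[OF f, where e = "\<lambda>r j. j - 1" and m = m and 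
      lo = "\<lambda>r j i. - 1 + real_of_int j / 2 - real_of_int i" and
      hi = "\<lambda>r j i. real_of_int (n $ r) - 1 + real_of_int j / 2 - real_of_int i"]
      Am_has_integral has_integral_unique
    by (simp add: signed_indicator_reflect_sum) blast
qed

text \<open>In this form the approximation is a sum over \<open>k\<close> of weighted integrals over boxes centred at
  \<open>k\<close>, to which Taylor's formula at \<open>k\<close> applies.\<close>

lemma Am_eq_windows:
  assumes "n \<ge> 0"
  shows "Am m n f = (\<Sum>j\<in>{1..vec (int m)}. gamv m j *
     (\<Sum>k\<in>{0..n - 1}. oint (rvec k - rvec j /\<^sub>R 2) (rvec k + rvec j /\<^sub>R 2) f))"
proof -
  have n0: "n $ r \<ge> 0" for r using assms by (simp add: less_eq_vec_def)
  have "rvec k - rvec j /\<^sub>R 2 = (\<chi> r. real_of_int (k $ r) - real_of_int (j $ r) / 2)"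
    "rvec k + rvec j /\<^sub>R 2 = (\<chi> r. real_of_int (k $ r) + real_of_int (j $ r) / 2)"
    "n - 1 = (\<chi> r. n $ r - 1)" for k j :: "int ^ 'p"
    by (simp_all add: vec_eq_iff rvec_def)
  then show ?thesis
    using gamv_oint_has_integral[OF f, where e = "\<lambda>r j. n $ r - 1" and m = m and 
      lo = "\<lambda>r j k. real_of_int k - real_of_int j / 2" and
      hi = "\<lambda>r j k. real_of_int k + real_of_int j / 2"]
      Am_has_integral has_integral_unique
    by (simp add: signed_indicator_window_sum[OF n0]) blast
qed

text \<open>Substitute \<open>b = 2 * i + 1 - j\<close> in every coordinate.\<close>

lemma Am_eq_tau:
  "Am m n f = (\<Sum>b\<in>{vec (1 - int m)..vec (int m - 1)}. tauv m (1 + vabs b) *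
         oint (rvec b /\<^sub>R 2 - 1 /\<^sub>R 2) (rvec n - 1 /\<^sub>R 2 - rvec b /\<^sub>R 2) f)"
proof -
  have "rvec b /\<^sub>R 2 - 1 /\<^sub>R 2 = (\<chi> r. real_of_int (b $ r) / 2 - 1 / 2)"
    "rvec n - 1 /\<^sub>R 2 - rvec b /\<^sub>R 2 = (\<chi> r. real_of_int (n $ r) - 1 / 2 - real_of_int (b $ r) / 2)"
        for b :: "int ^ 'p"
    by (simp_all add: vec_eq_iff rvec_def)
  then have A: "((\<lambda>x. (\<Prod>r\<in>UNIV. \<Sum>b\<in>{1 - int m..int m - 1}. tau m (nat (1 + \<bar>b\<bar>)) *
      signed_indicator (real_of_int b / 2 - 1 / 2) (real_of_int (n $ r) - 1 / 2 - real_of_int b / 2)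
          (x $ r)) * f x)
    has_integral (\<Sum>b\<in>{vec (1 - int m)..vec (int m - 1)}. tauv m (1 + vabs b) *
         oint (rvec b /\<^sub>R 2 - 1 /\<^sub>R 2) (rvec n - 1 /\<^sub>R 2 - rvec b /\<^sub>R 2) f)) UNIV"
    using tauv_oint_has_integral[OF f, where m = m and 
      lo = "\<lambda>r b. real_of_int b / 2 - 1 / 2" and
      hi = "\<lambda>r b. real_of_int (n $ r) - 1 / 2 - real_of_int b / 2"] by simp
  have eqs: "real_of_int (2 * i + 1 - j) / 2 - 1 / 2 = real_of_int i - real_of_int j / 2"
    "real_of_int k - 1 / 2 - real_of_int (2 * i + 1 - j) / 2
        = real_of_int k - 1 + real_of_int j / 2 - real_of_int i"
    for i j k by (simp_all add: field_simps)
  show ?thesis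
    by (rule has_integral_unique[OF Am_has_integral A[unfolded prod_tau_weight_eq eqs]])
qed

lemma Am_eq_tau_shifted:
  "Am m n f = (\<Sum>b\<in>{vec (1 - int m)..vec (int m - 1)}. tauv m (1 + vabs b) *
         oint (- 1 /\<^sub>R 2 - rvec b /\<^sub>R 2) (rvec n - 1 /\<^sub>R 2 - rvec b /\<^sub>R 2) f)"
proof -
  have "- 1 /\<^sub>R 2 - rvec b /\<^sub>R 2 = (\<chi> r. - 1 / 2 - real_of_int (b $ r) / 2)"
    "rvec n - 1 /\<^sub>R 2 - rvec b /\<^sub>R 2 = (\<chi> r. real_of_int (n $ r) - 1 / 2 - real_of_int (b $ r) / 2)"
        for b :: "int ^ 'p"
    by (simp_all add: vec_eq_iff rvec_def)
  then have A: "((\<lambda>x. (\<Prod>r\<in>UNIV. \<Sum>b\<in>{1 - int m..int m - 1}. tau m (nat (1 + \<bar>b\<bar>)) *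
      signed_indicator (- 1 / 2 - real_of_int b / 2)
          (real_of_int (n $ r) - 1 / 2 - real_of_int b / 2) (x $ r)) * f x)
    has_integral (\<Sum>b\<in>{vec (1 - int m)..vec (int m - 1)}. tauv m (1 + vabs b) *
         oint (- 1 /\<^sub>R 2 - rvec b /\<^sub>R 2) (rvec n - 1 /\<^sub>R 2 - rvec b /\<^sub>R 2) f)) UNIV"
    using tauv_oint_has_integral[OF f, where m = m and 
      lo = "\<lambda>r b. - 1 / 2 - real_of_int b / 2" and
      hi = "\<lambda>r b. real_of_int (n $ r) - 1 / 2 - real_of_int b / 2"] by simp
  have eqs: "- 1 / 2 - real_of_int (2 * i + 1 - j) / 2 = - 1 + real_of_int j / 2 - real_of_int i"
    "real_of_int k - 1 / 2 - real_of_int (2 * i + 1 - j) / 2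
        = real_of_int k - 1 + real_of_int j / 2 - real_of_int i"
    for i j k by (simp_all add: field_simps)
  show ?thesis
    using Am_has_integral A[unfolded prod_tau_weight_eq eqs, folded signed_indicator_reflect_sum]
    by (rule has_integral_unique)
qed

end

text \<open>Passes from the sums over \<open>b\<close> to the sums over \<open>a = \<bar>b\<bar>\<close> with an inner sum over signs.\<close>

lemma sum_group_vabs:
  fixes F :: "int ^ 'p \<Rightarrow> real"
  shows "(\<Sum>a\<in>{0..vec (int m - 1)}. tauv m (1 + a) * (\<Sum>b\<in>{b. vabs b = a}. F b))
    = (\<Sum>b\<in>{vec (1 - int m)..vec (int m - 1)}. tauv m (1 + vabs b) * F b)"
proof -
  have sub: "vabs ` {vec (1 - int m)..vec (int m - 1) :: int ^ 'p} \<subseteq> {0..vec (int m - 1)}"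
  proof (rule image_subsetI)
    fix b :: "int ^ 'p" assume "b \<in> {vec (1 - int m)..vec (int m - 1)}"
    then have "1 - int m \<le> b $ r" "b $ r \<le> int m - 1" for r by (simp_all add: less_eq_vec_def)
    then have "\<bar>b $ r\<bar> \<le> int m - 1" for r by (smt (verit))
    then show "vabs b \<in> {0..vec (int m - 1)}" by (simp add: vabs_def less_eq_vec_def)
  qed
  have eq: "{b. vabs b = a} = {b \<in> {vec (1 - int m)..vec (int m - 1)}. vabs b = a}"
      if "a \<in> {0..vec (int m - 1)}" for a
    using that by (auto simp: vabs_def less_eq_vec_def abs_le_iff) (smt (verit))+
  have "(\<Sum>b\<in>{vec (1 - int m)..vec (int m - 1)}. tauv m (1 + vabs b) * F b)
    = (\<Sum>a\<in>{0..vec (int m - 1)}. \<Sum>b\<in>{b \<in> {vec (1 - int m)..vec (int m - 1)}. vabs b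
        = a}. tauv m (1 + vabs b) * F b)"
    by (rule sum.group[OF finite_box_int_vec finite_box_int_vec sub, symmetric])
  also have "\<dots> = (\<Sum>a\<in>{0..vec (int m - 1)}. tauv m (1 + a) * (\<Sum>b\<in>{b. vabs b = a}. F b))"
    unfolding sum_distrib_left
    by (intro sum.cong refl eq[symmetric]) (auto simp: eq)
  finally show ?thesis ..
qed

lemma sum_gamv_mpow:
  "(\<Sum>j::int ^ 'p\<in>{1..vec (int m)}. gamv m j * mpow (rvec j) a)
      = (\<Prod>r\<in>UNIV. \<Sum>j=1..m. gam m j * real j ^ (a $ r))"
proof -
  have "(\<Sum>j::int ^ 'p\<in>{1..vec (int m)}. gamv m j * mpow (rvec j) a)
    = (\<Sum>j::int ^ 'p\<in>{1..vec (int m)}. \<Prod>r\<in>UNIV. gam m (nat (j $ r)) * real_of_int (j $ r) ^ (a $ r))"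
    by (simp add: gamv_def mpow_def rvec_def prod.distrib)
  also have "\<dots> = (\<Prod>r\<in>UNIV. \<Sum>j\<in>{1..int m}. gam m (nat j) * real_of_int j ^ (a $ r))"
    by (subst sum_box_prod[where g = "\<lambda>r j. gam m (nat j) * real_of_int j ^ (a $ r)"]) simp
  finally show ?thesis by (simp add: sum_gam_int)
qed

lemma sum_gamv_mpow_1:
  assumes "m \<ge> 1"
  shows "(\<Sum>j::int ^ 'p\<in>{1..vec (int m)}. gamv m j * mpow (rvec j) 1) = 1"
  using gam_moments[of 0 m] assms by (simp add: sum_gamv_mpow)

lemma sum_gamv_count:
  assumes "m \<ge> 1"
  shows "(\<Sum>j::int ^ 'p\<in>{1..vec (int m)}. gamv m j * (\<Sum>i\<in>{0..j - 1}. 1)) = 1"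
proof -
  have "(\<Sum>i\<in>{0..j - 1}. 1) = mpow (rvec j) 1" if "j \<in> {1..vec (int m)}" for j :: "int ^ 'p"
  proof -
    have "(\<Sum>i\<in>{0..j - 1}. 1) = (\<Prod>r\<in>UNIV. \<Sum>i\<in>{0..j $ r - 1}. (1::real))"
      using sum_box_prod[where a = 0 and b = "j - 1" and g = "\<lambda>_ _. 1 :: real"] by simp
    also have "\<dots> = mpow (rvec j) 1"
      using that by (auto simp: mpow_def rvec_def less_eq_vec_def intro!: prod.cong)
          (smt (verit) of_nat_nat)
    finally show ?thesis .
  qed
  then show ?thesis using sum_gamv_mpow_1[OF assms] by simp
qed

lemma sum_tauv:
  assumes "m \<ge> 1"
  shows "(\<Sum>b::int ^ 'p\<in>{vec (1 - int m)..vec (int m - 1)}. tauv m (1 + vabs b)) = 1"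
proof -
  have "(\<Sum>b\<in>{1 - int m..int m - 1}. tau m (nat (1 + \<bar>b\<bar>)))
      = (\<Sum>j\<in>{1..int m}. gam m (nat j) * real_of_int j ^ 1)"
    using sum_gam_tau[of m "\<lambda>_. 1"] by simp
  also have "\<dots> = 1" using gam_moments[of 0 m] assms by (subst sum_gam_int) simp
  finally show ?thesis
    using sum_box_prod[where g = "\<lambda>_ b. tau m (nat (1 + \<bar>b\<bar>))" and a = "vec (1 - int m)" and b
        = "vec (int m - 1) :: int ^ 'p"]
    by (simp add: tauv_def vabs_def)
qed

section \<open>Words, multi-indices and the multinomial theorem\<close>

text \<open>Iterated directional derivatives and powers of sums produce sums over words in the coordinate
  directions; their terms depend on a word only through its letter counts, which form a
  multi-index.\<close>

definition word_count :: "'p::finite list \<Rightarrow> nat ^ 'p" where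
  "word_count rs = (\<chi> r. count_list rs r)"

lemma finite_words: "finite {rs :: 'p::finite list. length rs = N}"
  using finite_lists_length_eq[of "UNIV :: 'p set" N] by simp

lemma sum_words_Suc:
  "(\<Sum>rs\<in>{rs :: 'p::finite list. length rs = Suc N}. G rs)
    = (\<Sum>rs\<in>{rs. length rs = N}. \<Sum>r\<in>UNIV. G (r # rs))"
  unfolding sum.cartesian_product
  by (rule sum.reindex_bij_witness[of _ "\<lambda>(rs, r). r # rs" "\<lambda>rs. (tl rs, hd rs)"])
    (auto simp: length_Suc_conv)

lemma msize_word_count: "msize (word_count rs) = length rs"
  unfolding msize_def word_count_def using sum_count_set[of rs UNIV] by simp

lemma word_count_surj: "\<exists>rs. word_count rs = a"
  using mderiv_witness[of a] by (auto simp: word_count_def vec_eq_iff)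

lemma finite_msize: "finite {a :: nat ^ 'p. msize a = N}"
proof -
  have "{a :: nat ^ 'p. msize a = N} \<subseteq> word_count ` {rs. length rs = N}"
  proof
    fix a :: "nat ^ 'p" assume "a \<in> {a. msize a = N}"
    moreover obtain rs where "word_count rs = a" using word_count_surj by blast
    ultimately show "a \<in> word_count ` {rs. length rs = N}" using msize_word_count[of rs] by auto
  qed
  then show ?thesis using finite_words finite_surj by blast
qed

lemma mfact_pos: "mfact a > 0"
  by (simp add: mfact_def prod_pos)

text \<open>The words with given letter counts are the permutations of one multiset.\<close>

lemma card_words_with_count:
  fixes a :: "nat ^ 'p"
  assumes "msize a = N"
  shows "real (card {rs. length rs = N \<and> word_count rs = a}) = fact N / mfact a"
proof -
  obtain rs0 where rs0: "word_count rs0 = a" using word_count_surj by blast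
  define A where "A = mset rs0"
  have count: "count A r = a $ r" for r
    using rs0 by (auto simp: A_def word_count_def vec_eq_iff count_mset)
  have "size A = N" using assms rs0 msize_word_count[of rs0] by (simp add: A_def)
  have "length rs = N \<and> word_count rs = a \<longleftrightarrow> rs \<in> permutations_of_multiset A" for rs
    unfolding permutations_of_multiset_def using assms count msize_word_count[of rs]
    by (auto simp: multiset_eq_iff word_count_def vec_eq_iff count_mset)
  then have set: "{rs. length rs = N \<and> word_count rs = a} = permutations_of_multiset A" by blast
  have "(\<Prod>x\<in>set_mset A. fact (count A x) :: nat) = (\<Prod>x\<in>UNIV. fact (a $ x))"
    by (rule prod.mono_neutral_cong_left) (auto simp: count not_in_iff)
  then have "card (permutations_of_multiset A) * (\<Prod>x\<in>UNIV. fact (a $ x)) = (fact N :: nat)"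
    using card_permutations_of_multiset_aux[of A] \<open>size A = N\<close> by simp
  then have "real (card (permutations_of_multiset A)) * mfact a = fact N"
    unfolding mfact_def by (metis (mono_tags, lifting) of_nat_fact of_nat_mult of_nat_prod
        prod.cong)
  then show ?thesis using mfact_pos[of a] by (simp add: set field_simps)
qed

lemma sum_words_by_count:
  fixes F :: "nat ^ 'p \<Rightarrow> real"
  shows "(\<Sum>rs\<in>{rs. length rs = N}. F (word_count rs))
      = (\<Sum>a\<in>{a. msize a = N}. fact N / mfact a * F a)"
proof -
  have "(\<Sum>rs\<in>{rs. length rs = N}. F (word_count rs))
    = (\<Sum>a\<in>{a. msize a = N}. \<Sum>rs\<in>{rs\<in>{rs. length rs = N}. word_count rs = a}. F (word_count rs))"
    by (rule sum.group[symmetric]) (auto simp: finite_words finite_msize msize_word_count)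
  also have "\<dots> = (\<Sum>a\<in>{a. msize a = N}. fact N / mfact a * F a)"
    by (intro sum.cong refl) (simp add: card_words_with_count)
  finally show ?thesis .
qed

lemma prod_list_word:
  fixes w :: "real ^ 'p"
  shows "prod_list (map (vec_nth w) rs) = mpow w (word_count rs)"
proof (induction rs)
  case (Cons x rs)
  have "mpow w (word_count (x # rs))
      = (\<Prod>r\<in>UNIV. (if r = x then w $ r else 1) * (w $ r) ^ count_list rs r)"
    unfolding mpow_def word_count_def by (intro prod.cong) auto
  also have "\<dots> = w $ x * mpow w (word_count rs)"
    by (simp add: prod.distrib prod.delta mpow_def word_count_def)
  finally show ?case using Cons by simp
qed (simp add: mpow_def word_count_def)

text \<open>Multiply out into words and collect words with equal letter counts.\<close>

lemma multinomial_vec: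
  fixes y :: "real ^ 'p"
  shows "(\<Sum>r\<in>UNIV. y $ r) ^ N = (\<Sum>a\<in>{a. msize a = N}. fact N / mfact a * mpow y a)"
proof -
  have "(\<Sum>r\<in>UNIV. y $ r) ^ N = (\<Sum>rs\<in>{rs. length rs = N}. prod_list (map (vec_nth y) rs))"
  proof (induction N)
    case (Suc N)
    then show ?case
      by (simp add: sum_words_Suc sum_distrib_left sum_distrib_right)
  qed simp
  then show ?thesis by (simp add: prod_list_word sum_words_by_count[of "mpow y"])
qed

section \<open>Taylor's formula in several variables\<close>

lemma cont_diff_continuous: "cont_diff k f \<Longrightarrow> continuous_on UNIV f"
  by (induction k) (use cont_diff_Suc in auto)

lemma cont_diff_mono: "cont_diff k f \<Longrightarrow> l \<le> k \<Longrightarrow> cont_diff l f"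
proof (induction k)
  case (Suc k)
  then show ?case using cont_diff_Suc by (cases "l = Suc k") auto
qed simp

lemma mderiv_word_count: "cont_diff (length rs) f \<Longrightarrow> mderiv (word_count rs) f = foldr partial rs f"
  by (rule mderiv_eq) (auto simp: word_count_def msize_word_count[unfolded word_count_def])

lemma continuous_on_mderiv:
  assumes "cont_diff N f" "msize a \<le> N"
  shows "continuous_on UNIV (mderiv a f)"
proof -
  obtain rs where rs: "word_count rs = a" using word_count_surj by blast
  then have "cont_diff (length rs + 0) f"
    using assms cont_diff_mono msize_word_count[of rs] by auto
  then show ?thesis
    using rs mderiv_word_count[of rs f] cont_diff_foldr[of rs 0 f] by auto
qed

lemma derivative_along_line:
  fixes g :: "real ^ 'p \<Rightarrow> real"
  assumes "g differentiable (at (x + s *\<^sub>R w))"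
  shows "((\<lambda>s. g (x + s *\<^sub>R w)) has_real_derivative (\<Sum>r\<in>UNIV. w $ r * partial r g (x + s *\<^sub>R w)))
      (at s)"
proof -
  let ?y = "x + s *\<^sub>R w"
  obtain g' where g': "(g has_derivative g') (at ?y)" using assms by (auto simp: differentiable_def)
  interpret g': bounded_linear g' using has_derivative_bounded_linear[OF g'] .
  have partial: "partial r g ?y = g' (axis r 1)" for r
  proof -
    have "((\<lambda>t. ?y + t *\<^sub>R axis r 1) has_derivative (\<lambda>c. c *\<^sub>R axis r 1)) (at 0)"
      by (auto intro!: derivative_eq_intros)
    from has_derivative_compose[OF this, of g g'] g'
    have "((\<lambda>t. g (?y + t *\<^sub>R axis r 1)) has_real_derivative g' (axis r 1)) (at 0)"
      unfolding has_field_derivative_def by (simp add: g'.scaleR mult_commute_abs)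
    then show ?thesis unfolding partial_def by (rule DERIV_imp_deriv)
  qed
  have "g' w = g' (\<Sum>r\<in>UNIV. w $ r *\<^sub>R axis r 1)"
    using basis_expansion[of w] by (simp add: scalar_mult_eq_scaleR)
  also have "\<dots> = (\<Sum>r\<in>UNIV. w $ r * partial r g ?y)"
    by (simp add: g'.sum g'.scaleR partial)
  finally have g'w: "g' w = (\<Sum>r\<in>UNIV. w $ r * partial r g ?y)" .
  have "((\<lambda>s. x + s *\<^sub>R w) has_derivative (\<lambda>c. c *\<^sub>R w)) (at s)"
    by (auto intro!: derivative_eq_intros)
  from has_derivative_compose[OF this g'] show ?thesis
    unfolding has_field_derivative_def by (simp add: g'.scaleR mult_commute_abs g'w)
qed

text \<open>Taylor's formula in one variable along the segment from \<open>x\<close> to \<open>x + w\<close>. The \<open>i\<close>-th derivative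
  along the segment is a sum over words of length \<open>i\<close>: each differentiation prepends a letter.
  Collecting words by letter counts gives the multi-index form.\<close>

lemma taylor_multivariate:
  fixes f :: "real ^ 'p \<Rightarrow> real"
  assumes f: "cont_diff N f" and N: "N > 0"
  shows "f (x + w) = (\<Sum>i<N. \<Sum>a\<in>{a. msize a = i}. mpow w a / mfact a * mderiv a f x)
    + real N * integral {0..1} (\<lambda>s. (1 - s) ^ (N - 1) *
        (\<Sum>a\<in>{a. msize a = N}. mpow w a / mfact a * mderiv a f (x + s *\<^sub>R w)))"
proof -
  define D where "D i s = (\<Sum>rs\<in>{rs. length rs = i}. prod_list (map (vec_nth w) rs)
      * foldr partial rs f (x + s *\<^sub>R w))"
    for i s
  have D_eq: "D i s = fact i * (\<Sum>a\<in>{a. msize a = i}. mpow w a / mfact a * mderiv a f (x + s *\<^sub>R w))"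
    if "i \<le> N" for i s
  proof -
    have "D i s = (\<Sum>rs\<in>{rs. length rs = i}. mpow w (word_count rs)
        * mderiv (word_count rs) f (x + s *\<^sub>R w))"
      unfolding D_def using cont_diff_mono[OF f that]
      by (intro sum.cong refl) (simp add: prod_list_word mderiv_word_count)
    also have "\<dots> = (\<Sum>a\<in>{a. msize a = i}. fact i / mfact a * (mpow w a * mderiv a f (x + s *\<^sub>R w)))"
      by (rule sum_words_by_count[of "\<lambda>a. mpow w a * mderiv a f (x + s *\<^sub>R w)"])
    finally show ?thesis by (simp add: sum_distrib_left mult_ac)
  qed
  have deriv: "(D i has_vector_derivative D (Suc i) s) (at s within {0..1})" if "i < N" for i s
  proof -
    have diff: "foldr partial rs f differentiable (at y)" if "length rs = i"
        for rs :: "'p list" and y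
    proof -
      have "cont_diff (length rs + Suc 0) f"
          by (rule cont_diff_mono[OF f]) (use that \<open>i < N\<close> in simp)
      from cont_diff_foldr[OF this] show ?thesis by auto
    qed
    have "(D i has_real_derivative (\<Sum>rs\<in>{rs. length rs = i}. prod_list (map (vec_nth w) rs) *
       (\<Sum>r\<in>UNIV. w $ r * partial r (foldr partial rs f) (x + s *\<^sub>R w)))) (at s)"
      unfolding D_def
      by (intro DERIV_sum DERIV_cmult derivative_along_line diff) simp
    also have "(\<Sum>rs\<in>{rs. length rs = i}. prod_list (map (vec_nth w) rs) *
       (\<Sum>r\<in>UNIV. w $ r * partial r (foldr partial rs f) (x + s *\<^sub>R w))) = D (Suc i) s"
      unfolding D_def sum_words_Suc by (simp add: sum_distrib_left mult_ac)
    finally show ?thesis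
      by (simp add: has_real_derivative_iff_has_vector_derivative has_vector_derivative_at_within)
  qed
  have D0: "D 0 = (\<lambda>s. f (x + s *\<^sub>R w))" by (simp add: D_def fun_eq_iff)
  have "f (x + w) = (\<Sum>i<N. ((1 - 0) ^ i / fact i) *\<^sub>R D i 0)
      + integral {0..1} (\<lambda>s. ((1 - s) ^ (N - 1) / fact (N - 1)) *\<^sub>R D N s)"
    using Taylor_integral[OF N D0 deriv] by simp
  also have "(\<Sum>i<N. ((1 - 0) ^ i / fact i) *\<^sub>R D i 0)
      = (\<Sum>i<N. \<Sum>a\<in>{a. msize a = i}. mpow w a / mfact a * mderiv a f x)"
    by (intro sum.cong refl) (simp add: D_eq)
  also have "(\<lambda>s. ((1 - s) ^ (N - 1) / fact (N - 1)) *\<^sub>R D N s) = (\<lambda>s. real N * ((1 - s) ^ (N - 1) *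
        (\<Sum>a\<in>{a. msize a = N}. mpow w a / mfact a * mderiv a f (x + s *\<^sub>R w))))"
    using N by (simp add: D_eq fun_eq_iff fact_reduce[of N])
  finally show ?thesis by simp
qed

section \<open>Integrals of products over boxes\<close>

lemma prod_Basis_vec: "(\<Prod>b\<in>(Basis :: (real ^ 'p) set). H b) = (\<Prod>r\<in>UNIV. H (axis r 1))"
  unfolding Basis_vec_def Basis_real_def
  by (simp add: UNION_singleton_eq_range prod.reindex inj_on_def axis_eq_axis)

text \<open>Lebesgue measure on \<open>real ^ 'p\<close> is the image of a product measure indexed by the basis
  vectors, so the integral of a product of functions of single coordinates factors.\<close>

lemma lborel_integral_prod:
  fixes G :: "'p::finite \<Rightarrow> real \<Rightarrow> real"
  assumes G: "\<And>r. integrable lborel (G r)"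
  shows "integral\<^sup>L lborel (\<lambda>x :: real ^ 'p. \<Prod>r\<in>UNIV. G r (x $ r))
      = (\<Prod>r\<in>UNIV. integral\<^sup>L lborel (G r))"
proof -
  interpret product_sigma_finite "\<lambda>_ :: real ^ 'p. lborel :: real measure" ..
  have [measurable]: "G r \<in> borel_measurable borel" for r
    using borel_measurable_integrable[OF G[of r]] by simp
  have nth: "(\<Sum>b\<in>(Basis :: (real ^ 'p) set). h b *\<^sub>R b) $ r = h (axis r 1)" for h r
  proof -
    have "(\<Sum>b\<in>(Basis :: (real ^ 'p) set). h b *\<^sub>R b) $ r = (\<Sum>b\<in>Basis. h b *\<^sub>R b) \<bullet> axis r 1"
      by (simp add: cart_eq_inner_axis)
    also have "\<dots> = h (axis r 1)" by (rule inner_sum_left_Basis) (auto simp: Basis_vec_def)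
    finally show ?thesis .
  qed
  have "integral\<^sup>L lborel (\<lambda>x :: real ^ 'p. \<Prod>r\<in>UNIV. G r (x $ r))
     = integral\<^sup>L (\<Pi>\<^sub>M b\<in>(Basis :: (real ^ 'p) set). lborel)
         (\<lambda>h. \<Prod>r\<in>UNIV. G r ((\<Sum>b\<in>Basis. h b *\<^sub>R b) $ r))"
    by (subst lborel_eq, subst integral_distr) (auto intro!: borel_measurable_prod)
  also have "\<dots> = integral\<^sup>L (\<Pi>\<^sub>M b\<in>(Basis :: (real ^ 'p) set). lborel)
      (\<lambda>h. \<Prod>b\<in>Basis. G (axis_index b) (h b))"
    by (simp only: nth prod_Basis_vec axis_index_axis)
  also have "\<dots> = (\<Prod>b\<in>(Basis :: (real ^ 'p) set). integral\<^sup>L lborel (G (axis_index b)))"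
    by (rule product_integral_prod) (auto simp: G)
  also have "\<dots> = (\<Prod>r\<in>UNIV. integral\<^sup>L lborel (G r))" by (simp add: prod_Basis_vec)
  finally show ?thesis .
qed

lemma integral_lborel_compact:
  fixes f :: "'a::euclidean_space \<Rightarrow> real"
  assumes "compact S" "continuous_on S f"
  shows "integral\<^sup>L lborel (\<lambda>x. indicator S x * f x) = integral S f"
  using set_borel_integral_eq_integral(2)[of S f] borel_integrable_compact[OF assms]
  by (simp add: set_integrable_def set_lebesgue_integral_def)

lemma integral_cbox_prod:
  fixes g :: "'p::finite \<Rightarrow> real \<Rightarrow> real" and a b :: "real ^ 'p"
  assumes g: "\<And>r. continuous_on {a $ r..b $ r} (g r)"
  shows "integral (cbox a b) (\<lambda>x. \<Prod>r\<in>UNIV. g r (x $ r)) = (\<Prod>r\<in>UNIV. integral {a $ r..b $ r} (g r))"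
proof -
  define G where "G r t = indicator {a $ r..b $ r} t * g r t" for r t
  have "continuous_on (cbox a b) (\<lambda>x. g r (x $ r))" for r
    by (rule continuous_on_compose2[OF g[of r]]) (auto intro!: continuous_intros simp: mem_box_cart)
  then have "continuous_on (cbox a b) (\<lambda>x. \<Prod>r\<in>UNIV. g r (x $ r))" by (intro continuous_on_prod)
  then have "integral (cbox a b) (\<lambda>x. \<Prod>r\<in>UNIV. g r (x $ r))
     = integral\<^sup>L lborel (\<lambda>x. indicator (cbox a b) x * (\<Prod>r\<in>UNIV. g r (x $ r)))"
    by (intro integral_lborel_compact[symmetric]) auto
  also have "(\<lambda>x. indicator (cbox a b) x * (\<Prod>r\<in>UNIV. g r (x $ r))) = (\<lambda>x. \<Prod>r\<in>UNIV. G r (x $ r))"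
  proof
    fix x
    have "indicator (cbox a b) x = (\<Prod>r\<in>UNIV. indicator {a $ r..b $ r} (x $ r) :: real)"
      by (auto simp: indicator_def mem_box_cart prod_zero_iff)
    then show "indicator (cbox a b) x * (\<Prod>r\<in>UNIV. g r (x $ r)) = (\<Prod>r\<in>UNIV. G r (x $ r))"
      by (simp add: G_def prod.distrib)
  qed
  also have "integral\<^sup>L lborel (\<lambda>x. \<Prod>r\<in>UNIV. G r (x $ r)) = (\<Prod>r\<in>UNIV. integral\<^sup>L lborel (G r))"
    unfolding G_def using borel_integrable_compact[OF _ g] by (intro lborel_integral_prod) simp
  also have "\<dots> = (\<Prod>r\<in>UNIV. integral {a $ r..b $ r} (g r))"
    unfolding G_def by (intro prod.cong refl integral_lborel_compact g) simp
  finally show ?thesis .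
qed

lemma integral_power_Icc:
  assumes "a \<le> b"
  shows "integral {a..b::real} (\<lambda>t. t ^ k) = (b ^ (k + 1) - a ^ (k + 1)) / (real k + 1)"
proof (rule integral_unique)
  have "((\<lambda>t. t ^ (k + 1) / (real k + 1)) has_real_derivative t ^ k) (at t within {a..b})"
      for t :: real
    using DERIV_cdivide[OF DERIV_pow[of "k + 1" t "{a..b}"], of "real k + 1"]
        by (simp add: add.commute)
  then have "((\<lambda>t. t ^ k) has_integral b ^ (k + 1) / (real k + 1) - a ^ (k + 1) / (real k + 1))
      {a..b}"
    using assms by (intro fundamental_theorem_of_calculus)
      (auto simp: has_real_derivative_iff_has_vector_derivative[symmetric])
  then show "((\<lambda>t. t ^ k) has_integral (b ^ (k + 1) - a ^ (k + 1)) / (real k + 1)) {a..b}"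
    by (simp add: diff_divide_distrib)
qed

lemma integral_abs_power: "integral {-1..1::real} (\<lambda>t. \<bar>t\<bar> ^ k) = 2 / (real k + 1)"
proof -
  have half: "integral {0..1::real} (\<lambda>t. \<bar>t\<bar> ^ k) = 1 / (real k + 1)"
    using integral_power_Icc[of 0 1 k] by (subst integral_cong[where g = "\<lambda>t. t ^ k"]) auto
  have "integral {-1..0::real} (\<lambda>t. \<bar>t\<bar> ^ k) = integral {0..1::real} (\<lambda>t. \<bar>t\<bar> ^ k)"
    using Henstock_Kurzweil_Integration.integral_reflect_real[of 1 0 "\<lambda>t. \<bar>t\<bar> ^ k"] by simp
  moreover have "integral {-1..0::real} (\<lambda>t. \<bar>t\<bar> ^ k) + integral {0..1} (\<lambda>t. \<bar>t\<bar> ^ k)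
      = integral {-1..1} (\<lambda>t. \<bar>t\<bar> ^ k)"
    by (rule Henstock_Kurzweil_Integration.integral_combine)
      (auto intro!: integrable_continuous_real continuous_intros)
  ultimately show ?thesis using half by simp
qed

lemma integral_mpow_unit: "integral (cbox 0 1) (\<lambda>v :: real ^ 'p. mpow v a)
    = (\<Prod>r\<in>UNIV. 1 / (real (a $ r) + 1))"
  unfolding mpow_def
  by (subst integral_cbox_prod[where g = "\<lambda>r t. t ^ (a $ r)"])
    (auto intro!: continuous_intros simp: integral_power_Icc)

lemma integral_mpow_sym:
  "integral (cbox (- 1) 1) (\<lambda>v :: real ^ 'p. mpow v a)
    = (\<Prod>r\<in>UNIV. if even (a $ r) then 2 / (real (a $ r) + 1) else 0)"
  unfolding mpow_def
  by (subst integral_cbox_prod[where g = "\<lambda>r t. t ^ (a $ r)"])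
    (auto intro!: continuous_intros prod.cong simp: integral_power_Icc)

lemma integral_abs_mpow_sym:
  "integral (cbox (- 1) 1) (\<lambda>v :: real ^ 'p. \<bar>mpow v a\<bar>) = (\<Prod>r\<in>UNIV. 2 / (real (a $ r) + 1))"
  unfolding mpow_def abs_prod power_abs
  by (subst integral_cbox_prod[where g = "\<lambda>r t. \<bar>t\<bar> ^ (a $ r)"])
    (auto intro!: continuous_intros prod.cong simp: integral_abs_power)

lemma integral_cbox_rescale:
  fixes f :: "real ^ 'p \<Rightarrow> real"
  assumes f: "continuous_on UNIV f" and d: "\<And>r. d $ r > 0"
  shows "integral (cbox (c - d) (c + d)) f
      = (\<Prod>r\<in>UNIV. d $ r) * integral (cbox (- 1) 1) (\<lambda>v. f (c + d * v))"
proof -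
  define I where "I = integral (cbox (c - d) (c + d)) f"
  have "continuous_on (cbox (c - d) (c + d)) f" using f continuous_on_subset by blast
  then have "(f has_integral I) (cbox (c - d) (c + d))"
    unfolding I_def using integrable_continuous integrable_integral by blast
  from has_integral_shift_cbox[OF this, of c]
  have "((\<lambda>x. f (x + c)) has_integral I) (cbox (- d) d)" by simp
  moreover have "d $ k \<noteq> 0" for k using d[of k] by simp
  ultimately have "((\<lambda>x. f ((\<chi> k. d $ k * x $ k) + c)) has_integral I /\<^sub>R \<bar>prod (vec_nth d) UNIV\<bar>)
      ((\<lambda>x. \<chi> k. x $ k / d $ k) ` cbox (- d) d)"
    by (rule has_integral_stretch_cart)
  also have "(\<lambda>x. f ((\<chi> k. d $ k * x $ k) + c)) = (\<lambda>v. f (c + d * v))"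
    by (simp add: times_vec_def add.commute)
  also have "(\<lambda>x. \<chi> k. x $ k / d $ k) ` cbox (- d) d = cbox (- 1) 1"
  proof safe
    fix x assume "x \<in> cbox (- d) d"
    then show "(\<chi> k. x $ k / d $ k) \<in> cbox (- 1) 1"
      using d by (auto simp: mem_box_cart field_simps)
  next
    fix y :: "real ^ 'p" assume y: "y \<in> cbox (- 1) 1"
    have "- (d $ k) \<le> d $ k * y $ k \<and> d $ k * y $ k \<le> d $ k" for k
    proof -
      have "- 1 \<le> y $ k" "y $ k \<le> 1" using y by (auto simp: mem_box_cart)
      then have "d $ k * (- 1) \<le> d $ k * y $ k" "d $ k * y $ k \<le> d $ k * 1"
        using d[of k] by (intro mult_left_mono; simp)+
      then show ?thesis by simp
    qed
    then have "d * y \<in> cbox (- d) d" by (simp add: mem_box_cart)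
    moreover have "y = (\<chi> k. (d * y) $ k / d $ k)" using d
        by (simp add: vec_eq_iff less_imp_neq[symmetric])
    ultimately show "y \<in> (\<lambda>x. \<chi> k. x $ k / d $ k) ` cbox (- d) d" by blast
  qed
  finally have "integral (cbox (- 1) 1) (\<lambda>v. f (c + d * v)) = I / (\<Prod>r\<in>UNIV. d $ r)"
    using d by (simp add: integral_unique abs_of_pos prod_pos divide_inverse)
  then show ?thesis using d by (simp add: I_def prod_zero_iff less_imp_neq[symmetric])
qed

section \<open>The summation formula\<close>

text \<open>The part of the remainder that belongs to one multi-index, one box with side lengths \<open>d\<close> and
  its centre \<open>x\<close>. The lemmas below provide the integrability needed to move finite sums through both
  integrals.\<close>

definition remainder_term :: "nat \<Rightarrow> (real ^ 'p \<Rightarrow> real) \<Rightarrow> nat ^ 'p \<Rightarrow> real ^ 'p \<Rightarrow> real ^ 'p \<Rightarrow> real"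
    where
  "remainder_term N f a d x = integral {0..1} (\<lambda>s. (1 - s) ^ (N - 1) *
     integral (cbox (- 1) 1) (\<lambda>v. mpow v a * mderiv a f (x + s *\<^sub>R (d * v) /\<^sub>R 2)))"

lemma continuous_on_mpow [continuous_intros]:
  "continuous_on S g \<Longrightarrow> continuous_on S (\<lambda>x. mpow (g x) a)"
  unfolding mpow_def by (intro continuous_intros continuous_on_prod) auto

lemma continuous_on_vec_mult:
  fixes g h :: "'a::topological_space \<Rightarrow> real ^ 'p"
  shows "continuous_on S g \<Longrightarrow> continuous_on S h \<Longrightarrow> continuous_on S (\<lambda>x. g x * h x)"
  unfolding times_vec_def by (intro continuous_intros)

context
  fixes f :: "real ^ 'p \<Rightarrow> real" and N :: nat
  assumes f: "cont_diff N f"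
begin

lemma continuous_on_mderiv_line:
  assumes "msize a \<le> N" "continuous_on S g" "continuous_on S h"
  shows "continuous_on S (\<lambda>p. mderiv a f (x + g p *\<^sub>R (d * h p) /\<^sub>R 2))"
  by (rule continuous_on_compose2[OF continuous_on_mderiv[OF f assms(1)]])
    (auto intro!: continuous_intros continuous_on_vec_mult assms)

lemma remainder_inner_integral:
  assumes "msize a \<le> N"
  shows "((\<lambda>v. mpow v a * mderiv a f (x + s *\<^sub>R (d * v) /\<^sub>R 2)) has_integral
     integral (cbox (- 1) 1) (\<lambda>v. mpow v a * mderiv a f (x + s *\<^sub>R (d * v) /\<^sub>R 2))) (cbox (- 1) 1)"
  by (intro integrable_integral integrable_continuous continuous_intros continuous_on_mderiv_line
      assms)

lemma remainder_term_has_integral: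
  assumes "msize a \<le> N"
  shows "((\<lambda>s. (1 - s) ^ (N - 1) *
     integral (cbox (- 1) 1) (\<lambda>v. mpow v a * mderiv a f (x + s *\<^sub>R (d * v) /\<^sub>R 2)))
     has_integral remainder_term N f a d x) {0..1}"
  unfolding remainder_term_def
  by (intro integrable_integral integrable_continuous_real continuous_intros
      integral_continuous_on_param)
    (unfold case_prod_beta, intro continuous_intros continuous_on_mderiv_line assms)

text \<open>Taylor's formula yields the integral over \<open>s\<close> inside the integral over \<open>v\<close>, the definition of
  the remainder has them in the other order.\<close>

lemma remainder_term_swap:
  assumes "msize a \<le> N"
  shows "((\<lambda>v. mpow v a * integral {0..1}
      (\<lambda>s. (1 - s) ^ (N - 1) * mderiv a f (x + s *\<^sub>R (d * v) /\<^sub>R 2)))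
     has_integral remainder_term N f a d x) (cbox (- 1) 1)"
proof -
  define H where "H s v = (1 - s) ^ (N - 1) * (mpow v a * mderiv a f (x + s *\<^sub>R (d * v) /\<^sub>R 2))"
      for s :: real and v
  have "continuous_on S (\<lambda>(s, v). H s v)" for S
    unfolding H_def case_prod_beta
    by (intro continuous_intros continuous_on_mderiv_line assms)
  then have "integral (cbox 0 1) (\<lambda>s. integral (cbox (- 1) 1) (H s))
      = integral (cbox (- 1) 1) (\<lambda>v. integral (cbox 0 1) (\<lambda>s. H s v))"
    by (rule integral_swap_continuous)
  moreover have "integral (cbox (- 1) 1) (H s) = (1 - s) ^ (N - 1) *
     integral (cbox (- 1) 1) (\<lambda>v. mpow v a * mderiv a f (x + s *\<^sub>R (d * v) /\<^sub>R 2))" for s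
    unfolding H_def by simp
  moreover have "integral (cbox 0 1) (\<lambda>s. H s v)
      = mpow v a * integral {0..1} (\<lambda>s. (1 - s) ^ (N - 1) * mderiv a f (x + s *\<^sub>R (d * v) /\<^sub>R 2))"
          for v
    unfolding H_def by (simp add: mult.left_commute[of _ "mpow v a"])
  ultimately have "integral (cbox (- 1) 1)
      (\<lambda>v. mpow v a * integral {0..1}
          (\<lambda>s. (1 - s) ^ (N - 1) * mderiv a f (x + s *\<^sub>R (d * v) /\<^sub>R 2)))
    = remainder_term N f a d x"
    by (simp add: remainder_term_def)
  moreover have "(\<lambda>v. mpow v a * integral (cbox 0 1)
      (\<lambda>s. (1 - s) ^ (N - 1) * mderiv a f (x + s *\<^sub>R (d * v) /\<^sub>R 2))) integrable_on (cbox (- 1) 1)"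
    by (intro integrable_continuous continuous_intros integral_continuous_on_param)
      (unfold case_prod_beta, intro continuous_intros continuous_on_mderiv_line assms)
  ultimately show ?thesis using integrable_integral by fastforce
qed

lemma mpow_half_mult: "mpow ((d * v) /\<^sub>R 2) a = mpow d a * mpow v a / 2 ^ msize a"
proof -
  have "mpow ((d * v) /\<^sub>R 2) a = (\<Prod>r\<in>UNIV. (d $ r) ^ (a $ r) * (v $ r) ^ (a $ r)
      * (1 / 2) ^ (a $ r))"
    unfolding mpow_def by (intro prod.cong refl) (simp add: power_mult_distrib power_divide)
  also have "\<dots> = mpow d a * mpow v a * (1 / 2) ^ msize a"
    by (simp add: prod.distrib mpow_def msize_def power_sum)
  finally show ?thesis by (simp add: power_divide)
qed

lemma taylor_integrated:
  assumes N: "N > 0"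
  shows "integral (cbox (- 1) 1) (\<lambda>v. f (x + (d * v) /\<^sub>R 2)) =
     (\<Sum>i<N. \<Sum>a\<in>{a. msize a = i}. mpow d a / 2 ^ i / mfact a * mderiv a f x
         * integral (cbox (- 1) 1) (\<lambda>v. mpow v a))
     + real N * (\<Sum>a\<in>{a. msize a = N}. mpow d a / 2 ^ N / mfact a * remainder_term N f a d x)"
proof (rule integral_unique)
  define K where "K a v = integral {0..1}
      (\<lambda>s. (1 - s) ^ (N - 1) * mderiv a f (x + s *\<^sub>R (d * v) /\<^sub>R 2))" for a v
  have taylor: "f (x + (d * v) /\<^sub>R 2)
      = (\<Sum>i<N. \<Sum>a\<in>{a. msize a = i}. mpow d a / 2 ^ i / mfact a * mderiv a f x * mpow v a)
     + real N * (\<Sum>a\<in>{a. msize a = N}. mpow d a / 2 ^ N / mfact a * (mpow v a * K a v))" for v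
  proof -
    have "((\<lambda>s. \<Sum>a\<in>{a. msize a = N}. mpow d a / 2 ^ N / mfact a * mpow v a *
       ((1 - s) ^ (N - 1) * mderiv a f (x + s *\<^sub>R (d * v) /\<^sub>R 2))) has_integral
      (\<Sum>a\<in>{a. msize a = N}. mpow d a / 2 ^ N / mfact a * mpow v a * K a v)) {0..1}"
      unfolding K_def
      by (intro has_integral_sum has_integral_mult_right integrable_integral finite_msize
         integrable_continuous_real continuous_intros continuous_on_mderiv_line) simp
    also have "(\<lambda>s. \<Sum>a\<in>{a. msize a = N}. mpow d a / 2 ^ N / mfact a * mpow v a *
       ((1 - s) ^ (N - 1) * mderiv a f (x + s *\<^sub>R (d * v) /\<^sub>R 2)))
      = (\<lambda>s. (1 - s) ^ (N - 1) * (\<Sum>a\<in>{a. msize a = N}. mpow ((d * v) /\<^sub>R 2) a / mfact a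
          * mderiv a f (x + s *\<^sub>R ((d * v) /\<^sub>R 2))))"
      unfolding mpow_half_mult sum_distrib_left
      by (intro ext sum.cong refl) (simp add: mult_ac)
    finally have rem: "integral {0..1}
        (\<lambda>s. (1 - s) ^ (N - 1) * (\<Sum>a\<in>{a. msize a = N}. mpow ((d * v) /\<^sub>R 2) a / mfact a
            * mderiv a f (x + s *\<^sub>R ((d * v) /\<^sub>R 2))))
       = (\<Sum>a\<in>{a. msize a = N}. mpow d a / 2 ^ N / mfact a * (mpow v a * K a v))"
      by (simp only: integral_unique mult.assoc)
    have "(\<Sum>i<N. \<Sum>a\<in>{a. msize a = i}. mpow ((d * v) /\<^sub>R 2) a / mfact a * mderiv a f x)
       = (\<Sum>i<N. \<Sum>a\<in>{a. msize a = i}. mpow d a / 2 ^ i / mfact a * mderiv a f x * mpow v a)"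
      unfolding mpow_half_mult by (intro sum.cong refl) simp
    then show ?thesis
      using taylor_multivariate[OF f N, of x "(d * v) /\<^sub>R 2"] unfolding rem by simp
  qed
  show "((\<lambda>v. f (x + (d * v) /\<^sub>R 2)) has_integral
     (\<Sum>i<N. \<Sum>a\<in>{a. msize a = i}. mpow d a / 2 ^ i / mfact a * mderiv a f x
         * integral (cbox (- 1) 1) (\<lambda>v. mpow v a))
     + real N * (\<Sum>a\<in>{a. msize a = N}. mpow d a / 2 ^ N / mfact a * remainder_term N f a d x))
         (cbox (- 1) 1)"
    unfolding taylor K_def
    by (intro has_integral_add has_integral_sum has_integral_mult_right finite_msize
        remainder_term_swap
        integrable_integral integrable_continuous continuous_intros) auto
qed

end


lemma oint_eq_integral:
  assumes "\<And>r. u $ r \<le> v $ r"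
  shows "oint u v h = integral (cbox u v) h"
proof -
  have "{r. u $ r > v $ r} = {}" "(\<chi> r. min (u $ r) (v $ r)) = u" "(\<chi> r. max (u $ r) (v $ r)) = v"
    using assms by (auto simp: vec_eq_iff not_less min_def max_def)
  then show ?thesis by (simp add: oint_def)
qed

lemma mpow_add: "mpow x (a + b) = mpow x a * mpow x b"
  by (simp add: mpow_def power_add prod.distrib)

lemma mpow_divide: "mpow (x /\<^sub>R c) a = mpow x a / c ^ msize a"
  by (simp add: mpow_def msize_def power_mult_distrib prod.distrib power_sum power_inverse
      prod_inversef[symmetric] divide_inverse)

lemma msize_0: "msize a = 0 \<longleftrightarrow> a = 0"
  by (auto simp: msize_def vec_eq_iff)

text \<open>A nonzero multi-index of size below \<open>2m\<close> either has an odd entry, and then its integral over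
  the symmetric cube is zero, or it has a nonzero even entry below \<open>2m\<close>, and then the sum over \<open>j\<close>
  has a vanishing factor by \<open>gam_moments\<close>.\<close>

lemma moment_cancellation:
  fixes a :: "nat ^ 'p"
  assumes "msize a < 2 * m"
  shows "(\<Sum>j\<in>{1..vec (int m)}. gamv m j * mpow (rvec j) (a + 1))
      * integral (cbox (- 1) 1) (\<lambda>v. mpow v a)
    = (if a = 0 then 2 ^ CARD('p) else 0)"
proof (cases "a = 0")
  case True
  have "(\<Sum>j::int ^ 'p\<in>{1..vec (int m)}. gamv m j * mpow (rvec j) 1) = 1"
    by (rule sum_gamv_mpow_1) (use assms in simp)
  with True show ?thesis by (simp add: integral_mpow_sym)
next
  case False
  then obtain r where r: "a $ r \<noteq> 0" by (auto simp: vec_eq_iff)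
  show ?thesis
  proof (cases "even (a $ r)")
    case True
    then obtain q where q: "a $ r = 2 * q" by auto
    have "a $ r \<le> msize a" unfolding msize_def by (rule member_le_sum) auto
    then have "q < m" "q \<noteq> 0" using q r assms by auto
    then have "(\<Sum>j=1..m. gam m j * real j ^ ((a + 1) $ r)) = 0"
      using gam_moments[of q m] q by simp
    then show ?thesis using False by (auto simp: sum_gamv_mpow intro!: prod_zero)
  next
    case odd: False
    then show ?thesis using False by (auto simp: integral_mpow_sym intro!: prod_zero)
  qed
qed

lemma oint_window:
  fixes f :: "real ^ 'p \<Rightarrow> real"
  assumes "continuous_on UNIV f" "j \<in> {1..vec (int m)}"
  shows "oint (rvec k - rvec j /\<^sub>R 2) (rvec k + rvec j /\<^sub>R 2) f
    = mpow (rvec j) 1 / 2 ^ CARD('p)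
        * integral (cbox (- 1) 1) (\<lambda>v. f (rvec k + (rvec j * v) /\<^sub>R 2))"
proof -
  have j: "j $ r \<ge> 1" for r using assms(2) by (simp add: less_eq_vec_def)
  have pos: "rvec j $ r > 0" for r using order_less_le_trans[OF zero_less_one j[of r]]
      by (simp add: rvec_def)
  have "oint (rvec k - rvec j /\<^sub>R 2) (rvec k + rvec j /\<^sub>R 2) f
     = integral (cbox (rvec k - rvec j /\<^sub>R 2) (rvec k + rvec j /\<^sub>R 2)) f"
    using pos by (intro oint_eq_integral) (simp add: less_imp_le)
  also have "\<dots> = (\<Prod>r\<in>UNIV. (rvec j /\<^sub>R 2) $ r)
      * integral (cbox (- 1) 1) (\<lambda>v. f (rvec k + (rvec j /\<^sub>R 2) * v))"
    using pos by (intro integral_cbox_rescale assms) simp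
  also have "(\<Prod>r\<in>UNIV. (rvec j /\<^sub>R 2) $ r) = mpow (rvec j) 1 / 2 ^ CARD('p)"
    using mpow_divide[of 2 "rvec j" 1] by (simp add: mpow_def msize_def)
  finally show ?thesis by simp
qed

lemma sum_swap4:
  "(\<Sum>j\<in>J. \<Sum>k\<in>K. \<Sum>a\<in>A. F j k a) = (\<Sum>a\<in>A. \<Sum>j\<in>J. \<Sum>k\<in>K. F j k a)"
  by (simp add: sum.swap[of _ K A] sum.swap[of _ J A])

lemma Rm_eq_remainder_terms:
  fixes f :: "real ^ 'p \<Rightarrow> real"
  assumes f: "cont_diff (2 * m) f"
  shows "Rm m n f = real (2 * m) / 2 ^ (2 * m + CARD('p)) * (\<Sum>a\<in>{a. msize a = 2 * m}. 1 / mfact a *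
     (\<Sum>j\<in>{1..vec (int m)}. gamv m j * mpow (rvec j) (a + 1) *
       (\<Sum>k\<in>{0..n - 1}. remainder_term (2 * m) f a (rvec j) (rvec k))))"
proof -
  have "integral {0..1::real} (\<lambda>s. (1 - s) ^ (2 * m - 1) *
         oint (- 1) 1 (\<lambda>v. mpow v a *
           (\<Sum>j\<in>{1..vec (int m)}. gamv m j * mpow (rvec j) (a + 1) *
             (\<Sum>k\<in>{0..n - 1}. mderiv a f (rvec k + s *\<^sub>R (rvec j * v) /\<^sub>R 2)))))
     = (\<Sum>j\<in>{1..vec (int m)}. gamv m j * mpow (rvec j) (a + 1) *
       (\<Sum>k\<in>{0..n - 1}. remainder_term (2 * m) f a (rvec j) (rvec k)))"
    if a: "a \<in> {a. msize a = 2 * m}" for a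
  proof (rule integral_unique)
    have a': "msize a \<le> 2 * m" using a by simp
    have inner: "oint (- 1) 1 (\<lambda>v. mpow v a *
           (\<Sum>j\<in>{1..vec (int m)}. gamv m j * mpow (rvec j) (a + 1) *
             (\<Sum>k\<in>{0..n - 1}. mderiv a f (rvec k + s *\<^sub>R (rvec j * v) /\<^sub>R 2))))
      = (\<Sum>j\<in>{1..vec (int m)}. gamv m j * mpow (rvec j) (a + 1) *
       (\<Sum>k\<in>{0..n - 1}. integral (cbox (- 1) 1)
           (\<lambda>v. mpow v a * mderiv a f (rvec k + s *\<^sub>R (rvec j * v) /\<^sub>R 2))))" for s
    proof -
      have "((\<lambda>v. \<Sum>j\<in>{1..vec (int m)}. gamv m j * mpow (rvec j) (a + 1) *
             (\<Sum>k\<in>{0..n - 1}. mpow v a * mderiv a f (rvec k + s *\<^sub>R (rvec j * v) /\<^sub>R 2)))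
        has_integral (\<Sum>j\<in>{1..vec (int m)}. gamv m j * mpow (rvec j) (a + 1) *
       (\<Sum>k\<in>{0..n - 1}. integral (cbox (- 1) 1)
           (\<lambda>v. mpow v a * mderiv a f (rvec k + s *\<^sub>R (rvec j * v) /\<^sub>R 2)))))
        (cbox (- 1) 1)"
        by (intro has_integral_sum has_integral_mult_right finite_box_int_vec
            remainder_inner_integral[OF f a'])
      also have "(\<lambda>v. \<Sum>j\<in>{1..vec (int m)}. gamv m j * mpow (rvec j) (a + 1) *
             (\<Sum>k\<in>{0..n - 1}. mpow v a * mderiv a f (rvec k + s *\<^sub>R (rvec j * v) /\<^sub>R 2)))
        = (\<lambda>v. mpow v a * (\<Sum>j\<in>{1..vec (int m)}. gamv m j * mpow (rvec j) (a + 1) *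
             (\<Sum>k\<in>{0..n - 1}. mderiv a f (rvec k + s *\<^sub>R (rvec j * v) /\<^sub>R 2))))"
        unfolding sum_distrib_left by (intro ext sum.cong refl) (simp only: mult_ac)
      finally show ?thesis
        by (subst oint_eq_integral) (simp_all only: integral_unique, simp)
    qed
    have "((\<lambda>s. \<Sum>j\<in>{1..vec (int m)}. gamv m j * mpow (rvec j) (a + 1) *
       (\<Sum>k\<in>{0..n - 1}. (1 - s) ^ (2 * m - 1)
           * integral (cbox (- 1) 1) (\<lambda>v. mpow v a
               * mderiv a f (rvec k + s *\<^sub>R (rvec j * v) /\<^sub>R 2))))
      has_integral (\<Sum>j\<in>{1..vec (int m)}. gamv m j * mpow (rvec j) (a + 1) *
       (\<Sum>k\<in>{0..n - 1}. remainder_term (2 * m) f a (rvec j) (rvec k)))) {0..1}"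
      by (intro has_integral_sum has_integral_mult_right finite_box_int_vec
          remainder_term_has_integral[OF f a'])
    also have "(\<lambda>s. \<Sum>j\<in>{1..vec (int m)}. gamv m j * mpow (rvec j) (a + 1) *
       (\<Sum>k\<in>{0..n - 1}. (1 - s) ^ (2 * m - 1)
           * integral (cbox (- 1) 1) (\<lambda>v. mpow v a
               * mderiv a f (rvec k + s *\<^sub>R (rvec j * v) /\<^sub>R 2))))
      = (\<lambda>s. (1 - s) ^ (2 * m - 1) *
         oint (- 1) 1 (\<lambda>v. mpow v a *
           (\<Sum>j\<in>{1..vec (int m)}. gamv m j * mpow (rvec j) (a + 1) *
             (\<Sum>k\<in>{0..n - 1}. mderiv a f (rvec k + s *\<^sub>R (rvec j * v) /\<^sub>R 2)))))"
      unfolding inner unfolding sum_distrib_left by (intro ext sum.cong refl) (simp only: mult_ac)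
    finally show "((\<lambda>s. (1 - s) ^ (2 * m - 1) *
         oint (- 1) 1 (\<lambda>v. mpow v a *
           (\<Sum>j\<in>{1..vec (int m)}. gamv m j * mpow (rvec j) (a + 1) *
             (\<Sum>k\<in>{0..n - 1}. mderiv a f (rvec k + s *\<^sub>R (rvec j * v) /\<^sub>R 2)))))
      has_integral (\<Sum>j\<in>{1..vec (int m)}. gamv m j * mpow (rvec j) (a + 1) *
       (\<Sum>k\<in>{0..n - 1}. remainder_term (2 * m) f a (rvec j) (rvec k)))) {0..1}" .
  qed
  moreover have "real m / 2 ^ (2 * m + CARD('p) - 1) = real (2 * m) / 2 ^ (2 * m + CARD('p))"
  proof -
    have "2 * m + CARD('p) = Suc (2 * m + CARD('p) - 1)" by simp
    then have "(2 :: real) ^ (2 * m + CARD('p)) = 2 * 2 ^ (2 * m + CARD('p) - 1)"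
        by (metis power_Suc)
    then show ?thesis by simp
  qed
  ultimately show ?thesis unfolding Rm_def by simp
qed

text \<open>Taylor expansion of \<open>f\<close> on every box about every \<open>k\<close>: by \<open>moment_cancellation\<close> only the value
  \<open>f k\<close> survives from the Taylor polynomial, and the remainder terms add up to \<open>Rm\<close>.\<close>

lemma sum_eq_Am_minus_Rm:
  fixes f :: "real ^ 'p \<Rightarrow> real"
  assumes m: "m \<ge> 1" and f: "cont_diff (2 * m) f" and n: "n \<ge> 0"
  shows "(\<Sum>k\<in>{0..n - 1}. f (rvec k)) = Am m n f - Rm m n f"
proof -
  define \<mu> where "\<mu> a = integral (cbox (- 1) 1) (\<lambda>v :: real ^ 'p. mpow v a)" for a
  define P where "P j k = (\<Sum>i<2 * m. \<Sum>a\<in>{a. msize a = i}. mpow (rvec j) a / 2 ^ i / mfact a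
      * mderiv a f (rvec k) * \<mu> a)"
    for j k :: "int ^ 'p"
  define Q where "Q j k = (\<Sum>a\<in>{a. msize a = 2 * m}. mpow (rvec j) a / 2 ^ (2 * m) / mfact a
      * remainder_term (2 * m) f a (rvec j) (rvec k))"
    for j k :: "int ^ 'p"
  let ?J = "{1..vec (int m)} :: (int ^ 'p) set" and ?K = "{0..n - 1}" and ?p
      = "2 ^ CARD('p) :: real"
  have cont: "continuous_on UNIV f" using f cont_diff_continuous by blast
  have window: "oint (rvec k - rvec j /\<^sub>R 2) (rvec k + rvec j /\<^sub>R 2) f
      = mpow (rvec j) 1 / ?p * (P j k + real (2 * m) * Q j k)" if "j \<in> ?J" for j k
    unfolding oint_window[OF cont that] P_def Q_def \<mu>_def
    by (subst taylor_integrated[OF f]) (use m in auto)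
  have "Am m n f = (\<Sum>j\<in>?J. gamv m j
      * (\<Sum>k\<in>?K. mpow (rvec j) 1 / ?p * (P j k + real (2 * m) * Q j k)))"
    unfolding Am_eq_windows[OF cont n]
    by (intro sum.cong refl arg_cong[where f = "(*) _"] window)
  also have "\<dots> = (\<Sum>j\<in>?J. gamv m j * (\<Sum>k\<in>?K. mpow (rvec j) 1 / ?p * P j k))
      + (\<Sum>j\<in>?J. gamv m j * (\<Sum>k\<in>?K. mpow (rvec j) 1 / ?p * (real (2 * m) * Q j k)))"
    by (simp only: distrib_left sum.distrib)
  also have "(\<Sum>j\<in>?J. gamv m j * (\<Sum>k\<in>?K. mpow (rvec j) 1 / ?p * P j k)) = (\<Sum>k\<in>?K. f (rvec k))"
  proof -
    have "(\<Sum>j\<in>?J. gamv m j * (\<Sum>k\<in>?K. mpow (rvec j) 1 / ?p * P j k))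
        = (\<Sum>k\<in>?K. \<Sum>j\<in>?J. gamv m j * (mpow (rvec j) 1 / ?p * P j k))"
      unfolding sum_distrib_left by (rule sum.swap)
    also have "\<dots> = (\<Sum>k\<in>?K. f (rvec k))"
    proof (rule sum.cong[OF refl])
      fix k
      have "(\<Sum>j\<in>?J. gamv m j * (mpow (rvec j) 1 / ?p * P j k))
        = (\<Sum>j\<in>?J. \<Sum>i<2 * m. \<Sum>a\<in>{a. msize a = i}. (gamv m j * mpow (rvec j) (a + 1)) *
             (\<mu> a * (mderiv a f (rvec k) / 2 ^ i / mfact a / ?p)))"
        unfolding P_def sum_distrib_left by (intro sum.cong refl) (simp add: mpow_add mult_ac)
      also have "\<dots> = (\<Sum>i<2 * m. \<Sum>a\<in>{a. msize a = i}. \<Sum>j\<in>?J. (gamv m j * mpow (rvec j) (a + 1)) *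
             (\<mu> a * (mderiv a f (rvec k) / 2 ^ i / mfact a / ?p)))"
        by (simp only: sum.swap[of _ "?J"])
      also have "\<dots> = (\<Sum>i<2 * m. \<Sum>a\<in>{a. msize a
          = i}. ((\<Sum>j\<in>?J. gamv m j * mpow (rvec j) (a + 1)) * \<mu> a) *
             (mderiv a f (rvec k) / 2 ^ i / mfact a / ?p))"
        by (simp only: sum_distrib_right mult.assoc)
      also have "\<dots> = (\<Sum>i<2 * m. \<Sum>a\<in>{a. msize a = i}. (if a = 0 then ?p else 0) *
             (mderiv a f (rvec k) / 2 ^ i / mfact a / ?p))"
        unfolding \<mu>_def by (intro sum.cong refl arg_cong2[where f = "(*)"] moment_cancellation) simp
      also have "\<dots> = (\<Sum>i<2 * m. if i = 0 then f (rvec k) else 0)"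
      proof (rule sum.cong[OF refl])
        fix i
        show "(\<Sum>a\<in>{a. msize a = i}. (if a = 0 then ?p else 0)
            * (mderiv a f (rvec k) / 2 ^ i / mfact a / ?p))
          = (if i = 0 then f (rvec k) else 0)"
        proof (cases "i = 0")
          case True
          have "word_count [] = (0 :: nat ^ 'p)" by (simp add: word_count_def vec_eq_iff)
          then have "mderiv 0 f = f" using mderiv_word_count[of "[]" f] cont by simp
          then show ?thesis using True by (simp add: msize_0 mfact_def)
        next
          case False
          then have nz: "a \<noteq> 0" if "a \<in> {a. msize a = i}" for a :: "nat ^ 'p"
            using that msize_0[of a] by simp
          have "(\<Sum>a\<in>{a. msize a = i}. (if a = 0 then ?p else 0)
              * (mderiv a f (rvec k) / 2 ^ i / mfact a / ?p)) = 0"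
            using nz by (intro sum.neutral ballI) (simp only: if_False mult_zero_left)
          then show ?thesis using False by simp
        qed
      qed
      also have "\<dots> = f (rvec k)" using m by simp
      finally show "(\<Sum>j\<in>?J. gamv m j * (mpow (rvec j) 1 / ?p * P j k)) = f (rvec k)" .
    qed
    finally show ?thesis .
  qed
  also have "(\<Sum>j\<in>?J. gamv m j * (\<Sum>k\<in>?K. mpow (rvec j) 1 / ?p * (real (2 * m) * Q j k))) = Rm m n f"
  proof -
    have rearrange: "g * (x / p * (N * (y / q / F * E)))
        = N / (q * p) * (1 / F * (g * (y * x) * E))"
      for g x p N y q F E :: real by (simp add: mult_ac)
    have "(\<Sum>j\<in>?J. gamv m j * (\<Sum>k\<in>?K. mpow (rvec j) 1 / ?p * (real (2 * m) * Q j k)))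
      = (\<Sum>j\<in>?J. \<Sum>k\<in>?K. \<Sum>a\<in>{a. msize a = 2 * m}. real (2 * m) / 2 ^ (2 * m + CARD('p))
          * (1 / mfact a *
          (gamv m j * mpow (rvec j) (a + 1) * remainder_term (2 * m) f a (rvec j) (rvec k))))"
      unfolding Q_def sum_distrib_left mpow_add power_add by (intro sum.cong refl rearrange)
    also have "\<dots> = Rm m n f"
      unfolding Rm_eq_remainder_terms[OF f] sum_distrib_left by (rule sum_swap4[THEN trans]) simp
    finally show ?thesis .
  qed
  finally show ?thesis by simp
qed

section \<open>The first bound on the remainder\<close>

lemma integral_one_minus_power:
    "N > 0 \<Longrightarrow> ((\<lambda>s. (1 - s) ^ (N - 1)) has_integral 1 / real N) {0..1::real}"
proof -
  assume N: "N > 0"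
  have "((\<lambda>s. - ((1 - s) ^ N / real N)) has_real_derivative (1 - s) ^ (N - 1)) (at s within {0..1})"
      for s
    using N by (auto intro!: derivative_eq_intros)
  then have "((\<lambda>s. (1 - s) ^ (N - 1))
      has_integral - ((1 - 1) ^ N / real N) - - ((1 - 0) ^ N / real N)) {0..1}"
    by (intro fundamental_theorem_of_calculus)
        (auto simp: has_real_derivative_iff_has_vector_derivative[symmetric])
  then show ?thesis using N by (simp add: zero_power)
qed

lemma mfact_Suc: "mfact (a + 1) = mfact a * (\<Prod>r\<in>UNIV. real (a $ r) + 1)"
  by (simp add: mfact_def prod.distrib mult.commute add.commute)

lemma mpow_rvec_nonneg: "j \<in> {1..b} \<Longrightarrow> mpow (rvec j) a \<ge> 0"
  unfolding mpow_def rvec_def less_eq_vec_def atLeastAtMost_iff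
  by (intro prod_nonneg ballI zero_le_power)
      (auto simp: one_vec_def intro: order_trans[OF zero_le_one])

text \<open>Triangle inequality termwise. The arguments \<open>k + s * j * v / 2\<close> stay in the cube on which the
  hypothesis holds as long as \<open>s < 1\<close>; for \<open>s = 1\<close> they may lie on the faces that the half-open cube
  omits, but then the factor \<open>(1 - s) ^ (2 * m - 1)\<close> is zero.\<close>

lemma Rm_bound:
  fixes f :: "real ^ 'p \<Rightarrow> real"
  assumes m: "m \<ge> 1" and f: "cont_diff (2 * m) f"
    and M: "\<And>(a::nat ^ 'p) (u::real ^ 'p). msize a = 2 * m \<Longrightarrow>
             (\<And>r. - real m / 2 < u $ r \<and> u $ r \<le> real m / 2) \<Longrightarrow>
             \<bar>\<Sum>k\<in>{0..n - 1}. mderiv a f (rvec k + u)\<bar> \<le> M"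
  shows "\<bar>Rm m n f\<bar> \<le> M / 2 ^ (2 * m) * (\<Sum>a\<in>{a::nat ^ 'p. msize a = 2 * m}. 1 / mfact (a + 1) *
                     (\<Sum>j\<in>{1..vec (int m)}. \<bar>gamv m j\<bar> * mpow (rvec j) (a + 1)))"
proof -
  let ?J = "{1..vec (int m)} :: (int ^ 'p) set" and ?K = "{0..n - 1}" and ?A
      = "{a::nat ^ 'p. msize a = 2 * m}"
  define G where "G a s v = (\<Sum>j\<in>?J. gamv m j * mpow (rvec j) (a + 1) *
      (\<Sum>k\<in>?K. mderiv a f (rvec k + s *\<^sub>R (rvec j * v) /\<^sub>R 2)))" for a s v
  define T where "T a = integral {0..1}
      (\<lambda>s. (1 - s) ^ (2 * m - 1) * oint (- 1) 1 (\<lambda>v. mpow v a * G a s v))" for a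
  define W where "W a = (\<Sum>j\<in>?J. \<bar>gamv m j\<bar> * mpow (rvec j) (a + 1))" for a
  define I where "I a = (\<Prod>r\<in>UNIV. 2 / (real (a $ r) + 1))" for a :: "nat ^ 'p"
  have G_bound: "\<bar>G a s v\<bar> \<le> W a * M"
      if a: "a \<in> ?A" and s: "0 \<le> s" "s < 1" and v: "v \<in> cbox (- 1) 1" for a s v
  proof -
    have "\<bar>G a s v\<bar> \<le> (\<Sum>j\<in>?J. \<bar>gamv m j * mpow (rvec j) (a + 1) *
      (\<Sum>k\<in>?K. mderiv a f (rvec k + s *\<^sub>R (rvec j * v) /\<^sub>R 2))\<bar>)"
      unfolding G_def by (rule sum_abs)
    also have "\<dots> \<le> (\<Sum>j\<in>?J. \<bar>gamv m j\<bar> * mpow (rvec j) (a + 1) * M)"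
    proof (rule sum_mono)
      fix j assume j: "j \<in> ?J"
      have "- real m / 2 < (s *\<^sub>R (rvec j * v) /\<^sub>R 2) $ r \<and> (s *\<^sub>R (rvec j * v) /\<^sub>R 2) $ r
          \<le> real m / 2" for r
      proof -
        have "1 \<le> j $ r" "j $ r \<le> int m" using j by (simp_all add: less_eq_vec_def)
        then have jr: "0 \<le> real_of_int (j $ r)" "real_of_int (j $ r) \<le> real m" by linarith+
        have "\<bar>v $ r\<bar> \<le> 1" using v by (simp add: mem_box_cart abs_le_iff minus_le_iff)
        then have "\<bar>real_of_int (j $ r) * v $ r\<bar> \<le> real m * 1"
          unfolding abs_mult using jr by (intro mult_mono) auto
        then have "s * \<bar>real_of_int (j $ r) * v $ r\<bar> \<le> s * real m"
          using s by (intro mult_left_mono) auto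
        also have "\<dots> < 1 * real m" using s m by (intro mult_strict_right_mono) auto
        finally have "\<bar>s * (real_of_int (j $ r) * v $ r)\<bar> < real m" using s by (simp add: abs_mult)
        then show ?thesis unfolding abs_less_iff by (simp add: rvec_def)
      qed
      then have "\<bar>\<Sum>k\<in>?K. mderiv a f (rvec k + s *\<^sub>R (rvec j * v) /\<^sub>R 2)\<bar> \<le> M"
        using a by (intro M) auto
      then show "\<bar>gamv m j * mpow (rvec j) (a + 1)
          * (\<Sum>k\<in>?K. mderiv a f (rvec k + s *\<^sub>R (rvec j * v) /\<^sub>R 2))\<bar>
          \<le> \<bar>gamv m j\<bar> * mpow (rvec j) (a + 1) * M"
        unfolding abs_mult using mpow_rvec_nonneg[OF j, of "a + 1"] by (intro mult_mono) auto
    qed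
    finally show ?thesis by (simp add: W_def sum_distrib_right)
  qed
  have cont: "continuous_on S (\<lambda>p. mpow (h p) a * G a (g p) (h p))"
    if "a \<in> ?A" "continuous_on S g" "continuous_on S h"
        for S a and g :: "'z::topological_space \<Rightarrow> real" and h
    unfolding G_def using that by (intro continuous_intros continuous_on_mderiv_line[OF f]) auto
  have oint_eq: "oint (- 1) 1 h = integral (cbox (- 1) 1) h" for h :: "real ^ 'p \<Rightarrow> real"
    by (rule oint_eq_integral) simp
  have T_bound: "\<bar>T a\<bar> \<le> W a * M * I a / real (2 * m)" if a: "a \<in> ?A" for a
  proof -
    have inner: "\<bar>oint (- 1) 1 (\<lambda>v. mpow v a * G a s v)\<bar> \<le> W a * M * I a" if s: "0 \<le> s" "s < 1"
        for s
    proof -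
      have "norm (integral (cbox (- 1) 1) (\<lambda>v. mpow v a * G a s v))
         \<le> integral (cbox (- 1) 1) (\<lambda>v. \<bar>mpow v a\<bar> * (W a * M))"
      proof (rule integral_norm_bound_integral)
        show "(\<lambda>v. mpow v a * G a s v) integrable_on cbox (- 1) 1"
          by (intro integrable_continuous cont a continuous_intros)
        show "(\<lambda>v. \<bar>mpow v a\<bar> * (W a * M)) integrable_on cbox (- 1) 1"
          by (intro integrable_continuous continuous_intros)
        show "norm (mpow v a * G a s v) \<le> \<bar>mpow v a\<bar> * (W a * M)" if "v \<in> cbox (- 1) 1" for v
          using G_bound[OF a s that] by (simp add: abs_mult mult_left_mono)
      qed
      also have "\<dots> = W a * M * I a"
        by (simp add: integral_abs_mpow_sym I_def)
      finally show ?thesis by (simp add: oint_eq)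
    qed
    have "norm (T a) \<le> integral {0..1} (\<lambda>s. (1 - s) ^ (2 * m - 1) * (W a * M * I a))"
      unfolding T_def
    proof (rule integral_norm_bound_integral)
      show "(\<lambda>s. (1 - s) ^ (2 * m - 1) * oint (- 1) 1 (\<lambda>v. mpow v a * G a s v)) integrable_on
          {0..1}"
        unfolding oint_eq
        by (intro integrable_continuous_real continuous_intros integral_continuous_on_param)
          (unfold case_prod_beta, intro cont a continuous_intros)
      show "(\<lambda>s. (1 - s) ^ (2 * m - 1) * (W a * M * I a)) integrable_on {0..1::real}"
        by (intro integrable_continuous_real continuous_intros)
      show "norm ((1 - s) ^ (2 * m - 1) * oint (- 1) 1 (\<lambda>v. mpow v a * G a s v))
          \<le> (1 - s) ^ (2 * m - 1) * (W a * M * I a)"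
        if "s \<in> {0..1}" for s
      proof (cases "s = 1")
        case True
        have "2 * m - 1 > 0" using m by linarith
        then show ?thesis using True by (simp add: zero_power)
      next
        case False
        then show ?thesis using that inner[of s] by (simp add: abs_mult mult_left_mono)
      qed
    qed
    also have "\<dots> = 1 / real (2 * m) * (W a * M * I a)"
      by (intro integral_unique has_integral_mult_left integral_one_minus_power) (use m in simp)
    finally show ?thesis by simp
  qed
  have "\<bar>Rm m n f\<bar> = real m / 2 ^ (2 * m + CARD('p) - 1) * \<bar>\<Sum>a\<in>?A. 1 / mfact a * T a\<bar>"
    unfolding Rm_def T_def G_def by (simp add: abs_mult)
  also have "\<dots> \<le> real m / 2 ^ (2 * m + CARD('p) - 1)
      * (\<Sum>a\<in>?A. 1 / mfact a * (W a * M * I a / real (2 * m)))"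
  proof (rule mult_left_mono)
    have "\<bar>\<Sum>a\<in>?A. 1 / mfact a * T a\<bar> \<le> (\<Sum>a\<in>?A. \<bar>1 / mfact a * T a\<bar>)" by (rule sum_abs)
    also have "\<dots> \<le> (\<Sum>a\<in>?A. 1 / mfact a * (W a * M * I a / real (2 * m)))"
    proof (rule sum_mono)
      fix a assume "a \<in> ?A"
      then show "\<bar>1 / mfact a * T a\<bar> \<le> 1 / mfact a * (W a * M * I a / real (2 * m))"
        unfolding abs_mult using T_bound[of a] mfact_pos[of a] by (intro mult_mono) auto
    qed
    finally show "\<bar>\<Sum>a\<in>?A. 1 / mfact a * T a\<bar>
        \<le> (\<Sum>a\<in>?A. 1 / mfact a * (W a * M * I a / real (2 * m)))" .
  qed simp
  also have "\<dots> = (\<Sum>a\<in>?A. M / 2 ^ (2 * m) * (1 / mfact (a + 1) * W a))"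
    unfolding sum_distrib_left
  proof (rule sum.cong[OF refl])
    fix a :: "nat ^ 'p"
    define P where "P = (\<Prod>r\<in>UNIV. real (a $ r) + 1)"
    have I: "I a = 2 ^ CARD('p) / P" by (simp add: I_def P_def prod_dividef)
    have "2 * m + CARD('p) = Suc (2 * m + CARD('p) - 1)" by simp
    then have "(2 :: real) * 2 ^ (2 * m + CARD('p) - 1) = 2 ^ (2 * m) * 2 ^ CARD('p)"
      by (metis power_Suc power_add)
    then have two: "(2 :: real) ^ CARD('p) / 2 ^ (2 * m + CARD('p) - 1) = 2 / 2 ^ (2 * m)"
      by (simp add: field_simps)
    have "real m / 2 ^ (2 * m + CARD('p) - 1) * (1 / mfact a * (W a * M * I a / real (2 * m)))
       = (2 ^ CARD('p) / 2 ^ (2 * m + CARD('p) - 1)) * (M * W a / (2 * mfact a * P))"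
      unfolding I using m by (simp add: mult_ac)
    also have "\<dots> = M / 2 ^ (2 * m) * (1 / mfact (a + 1) * W a)"
      unfolding two mfact_Suc P_def[symmetric] by simp
    finally show "real m / 2 ^ (2 * m + CARD('p) - 1)
        * (1 / mfact a * (W a * M * I a / real (2 * m)))
       = M / 2 ^ (2 * m) * (1 / mfact (a + 1) * W a)" .
  qed
  finally show ?thesis unfolding W_def by (simp only: sum_distrib_left)
qed

section \<open>Central binomial coefficients\<close>

text \<open>The partial products in Wallis's formula increase to \<open>pi / 2\<close>, and the \<open>n\<close>-th one equals the
  left-hand side divided by \<open>2 * n + 1\<close>.\<close>

lemma central_binomial_wallis: "(4 ^ n / real ((2 * n) choose n))\<^sup>2 \<le> pi * (real n + 1 / 2)"
proof -
  define W where "W n = (\<Prod>k=1..n. (4 * real k ^ 2) / (4 * real k ^ 2 - 1))" for n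
  have W_Suc: "W (Suc n) = W n * ((4 * real (Suc n) ^ 2) / (4 * real (Suc n) ^ 2 - 1))" for n
    unfolding W_def by (subst prod.nat_ivl_Suc') simp_all
  have four_sq: "4 * real k ^ 2 > 1" if "k \<ge> 1" for k
  proof -
    have "1 \<le> real k ^ 2" using that by (intro one_le_power) simp
    then show ?thesis by linarith
  qed
  then have W_pos: "W n > 0" for n unfolding W_def by (intro prod_pos) force
  have "incseq W"
  proof (rule incseq_SucI)
    fix n
    have "1 \<le> 4 * real (Suc n) ^ 2 / (4 * real (Suc n) ^ 2 - 1)"
      using four_sq[of "Suc n"] by (subst le_divide_eq_1_pos) simp_all
    then have "W n * 1 \<le> W (Suc n)" unfolding W_Suc using W_pos[of n] by (intro mult_left_mono) auto
    then show "W n \<le> W (Suc n)" by simp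
  qed
  then have W_le: "W n \<le> pi / 2"
    using wallis unfolding W_def by (intro incseq_le) auto
  have "(4 ^ n / real ((2 * n) choose n))\<^sup>2 = W n * (2 * real n + 1)"
  proof (induction n)
    case (Suc n)
    have binomial: "real ((2 * k) choose k) = fact (2 * k) / (fact k * fact k)" for k
      by (simp add: binomial_fact mult_2)
    have double: "fact (2 * Suc n) = 2 * (real n + 1) * (2 * real n + 1) * fact (2 * n)"
      by (simp add: algebra_simps)
    have Suc: "fact (Suc n) = (real n + 1) * (fact n :: real)" by (simp add: algebra_simps)
    have cancel: "q * 4 / (2 * u * y * A / (u * F * (u * F))) = q / (A / (F * F)) * (2 * u / y)"
      if "u \<noteq> 0" for q u y A F :: real
      using that by (simp add: divide_simps)
    have "4 ^ Suc n / real ((2 * Suc n) choose Suc n)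
        = 4 ^ n / real ((2 * n) choose n) * (2 * (real n + 1) / (2 * real n + 1))"
      unfolding binomial double Suc power_Suc2 by (rule cancel) linarith
    then have "(4 ^ Suc n / real ((2 * Suc n) choose Suc n))\<^sup>2
      = (4 ^ n / real ((2 * n) choose n))\<^sup>2 * ((2 * real n + 2) / (2 * real n + 1))\<^sup>2"
      by (simp only: power_mult_distrib distrib_left mult_1_right)
    also have "\<dots> = W n * (2 * real n + 1) * ((2 * real n + 2) / (2 * real n + 1))\<^sup>2"
      by (simp only: Suc.IH)
    also have "\<dots> = W (Suc n) * (2 * real (Suc n) + 1)"
    proof -
      define a b c where "a = 2 * real n + 1" and "b = 2 * real n + 3" and "c = 2 * real n + 2"
      have "4 * real (Suc n) ^ 2 = c\<^sup>2" "c\<^sup>2 - 1 = a * b" "2 * real (Suc n) + 1 = b"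
        by (simp_all add: a_def b_def c_def power2_eq_square algebra_simps)
      moreover have "a \<noteq> 0" "b \<noteq> 0" unfolding a_def b_def by linarith+
      moreover have "2 * real n + 1 = a" "2 * real n + 2 = c" by (simp_all add: a_def c_def)
      ultimately show ?thesis unfolding W_Suc by (simp add: power2_eq_square)
    qed
    finally show ?case .
  qed (simp add: W_def)
  also have "\<dots> \<le> pi / 2 * (2 * real n + 1)" using W_le by (intro mult_right_mono) auto
  finally show ?thesis by (simp add: algebra_simps)
qed

section \<open>The constants Lambda and kappa\<close>

definition log_Lambda :: "real \<Rightarrow> real" where
  "log_Lambda t = - (1 - t) * ln (1 - t) - (1 + t) * ln (1 + t) + 2 * ln t"

definition log_Lambda_deriv :: "real \<Rightarrow> real" where
  "log_Lambda_deriv t = 2 / t - ln ((1 + t) / (1 - t))"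

lemma Lambda_eq_exp: "t \<in> {0<..<1} \<Longrightarrow> Lambda t = exp (log_Lambda t)"
proof -
  assume t: "t \<in> {0<..<1}"
  then have "t\<^sup>2 = exp (2 * ln t)" by (simp add: exp_double)
  with t have "Lambda t = exp ((t - 1) * ln (1 - t)) * exp ((- 1 - t) * ln (1 + t))
      * exp (2 * ln t)"
    by (simp add: Lambda_def powr_def)
  also have "\<dots> = exp (log_Lambda t)"
    unfolding exp_add[symmetric] log_Lambda_def by (simp add: algebra_simps)
  finally show ?thesis .
qed

lemma log_Lambda_has_derivative:
  assumes "t \<in> {0<..<1}"
  shows "(log_Lambda has_real_derivative log_Lambda_deriv t) (at t)"
proof -
  have fraction: "(t - 1) / (1 - t) = - 1" using assms by (simp add: divide_simps)
  have "(log_Lambda has_real_derivative (ln (1 - t) + 1 - ln (1 + t) - 1 + 2 / t)) (at t)"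
    unfolding log_Lambda_def using assms fraction
    by (auto intro!: derivative_eq_intros)
  moreover have "ln (1 - t) + 1 - ln (1 + t) - 1 + 2 / t = log_Lambda_deriv t"
    using assms by (simp add: log_Lambda_deriv_def ln_div)
  ultimately show ?thesis by simp
qed

lemma log_Lambda_deriv_antimono:
  assumes "0 < s" "s \<le> t" "t < 1"
  shows "log_Lambda_deriv t \<le> log_Lambda_deriv s"
proof -
  have "2 / t \<le> 2 / s" using assms by (simp add: frac_le)
  moreover have "ln ((1 + s) / (1 - s)) \<le> ln ((1 + t) / (1 - t))"
    using assms by (subst ln_le_cancel_iff) (auto intro!: frac_le)
  ultimately show ?thesis by (simp add: log_Lambda_deriv_def)
qed

text \<open>The derivative is decreasing, so \<open>log_Lambda\<close> is concave and lies below its tangents. The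
  tangent at a critical point shows that it is a global maximum; the tangent at \<open>5 / 6\<close> bounds the
  maximum from above.\<close>

lemma log_Lambda_tangent:
  assumes "s \<in> {0<..<1}" "t \<in> {0<..<1}"
  shows "log_Lambda t \<le> log_Lambda s + log_Lambda_deriv s * (t - s)"
proof (cases s t rule: linorder_cases)
  case less
  obtain z where z: "s < z" "z < t" "log_Lambda t - log_Lambda s = (t - s) * log_Lambda_deriv z"
    using MVT2[OF less, of log_Lambda log_Lambda_deriv] log_Lambda_has_derivative assms by force
  have "(t - s) * log_Lambda_deriv z \<le> (t - s) * log_Lambda_deriv s"
    using z assms by (intro mult_left_mono log_Lambda_deriv_antimono) auto
  then show ?thesis using z(3) by (simp add: mult.commute)
next
  case greater
  obtain z where z: "t < z" "z < s" "log_Lambda s - log_Lambda t = (s - t) * log_Lambda_deriv z"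
    using MVT2[OF greater, of log_Lambda log_Lambda_deriv] log_Lambda_has_derivative assms by force
  have "(s - t) * log_Lambda_deriv s \<le> (s - t) * log_Lambda_deriv z"
    using z assms by (intro mult_left_mono log_Lambda_deriv_antimono) auto
  then show ?thesis using z(3) by (simp add: algebra_simps)
qed simp

text \<open>Reduces a bound on \<open>exp (k / l)\<close> to a comparison of rational powers by \<open>exp 1 < 2.72\<close>.\<close>

lemma exp_fraction_less:
  assumes "0 < y" "(272 / 100) ^ k < y ^ l" "x * real l = real k" "l > 0"
  shows "exp x < y"
proof -
  have "exp x ^ l = exp 1 ^ k" using assms(3) by (simp add: exp_of_nat_mult[symmetric] mult.commute)
  also have "\<dots> \<le> (272 / 100) ^ k" using e_less_272 by (intro power_mono) auto
  also have "\<dots> < y ^ l" by (rule assms)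
  finally show ?thesis using assms(1) power_less_imp_less_base[of "exp x" l y] by simp
qed

lemma ln_11_bounds: "43 / 18 < ln (11 :: real)" "ln (11 :: real) < 12 / 5"
proof -
  have "exp (43 / 18 :: real) < 11"
    by (rule exp_fraction_less[where k = 43 and l = 18]) (simp_all add: power_divide)
  then show "43 / 18 < ln (11 :: real)" by (metis exp_less_cancel_iff exp_ln zero_less_numeral)
  \<comment> \<open>\<open>841 / 800\<close> is the quadratic Taylor polynomial of \<open>exp\<close> at \<open>1 / 20\<close>, and \<open>48 / 20 = 12 / 5\<close>.\<close>
  have "1 + (1 / 20) + (1 / 20)\<^sup>2 / 2 \<le> exp (1 / 20 :: real)"
      by (rule exp_lower_Taylor_quadratic) simp
  then have "(841 / 800) ^ 48 \<le> exp (1 / 20 :: real) ^ 48"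
      by (intro power_mono) (simp_all add: power2_eq_square)
  moreover have "exp (1 / 20 :: real) ^ 48 = exp (12 / 5)" by (simp add: exp_of_nat_mult[symmetric])
  moreover have "(11 :: real) < (841 / 800) ^ 48" by (simp add: power_divide)
  ultimately have "11 < exp (12 / 5 :: real)" by linarith
  then show "ln (11 :: real) < 12 / 5" by (metis exp_less_cancel_iff exp_ln zero_less_numeral)
qed

lemma Lambda_critical_point:
  obtains t where "5 / 6 < t" "t < 834 / 1000" "log_Lambda_deriv t = 0"
proof -
  have "log_Lambda_deriv (5 / 6) = 12 / 5 - ln 11" by (simp add: log_Lambda_deriv_def)
  then have pos: "log_Lambda_deriv (5 / 6) > 0" using ln_11_bounds by simp
  \<comment> \<open>At \<open>t = 0.834\<close> the quotient \<open>(1 + t) / (1 - t)\<close> is \<open>1834 / 166\<close>, while \<open>2 / t < 12 / 5\<close>.\<close>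
  have "exp (12 / 5 :: real) < 1834 / 166"
    by (rule exp_fraction_less[where k = 12 and l = 5]) (simp_all add: power_divide)
  then have "12 / 5 < ln (1834 / 166 :: real)" 
    by (metis exp_less_cancel_iff exp_ln divide_pos_pos zero_less_numeral)
  then have neg: "log_Lambda_deriv (834 / 1000) < 0" by (simp add: log_Lambda_deriv_def)
  have "\<forall>x. 5 / 6 \<le> x \<and> x \<le> 834 / 1000 \<longrightarrow> isCont log_Lambda_deriv x"
    unfolding log_Lambda_deriv_def by (auto intro!: continuous_intros)
  then obtain t where t: "5 / 6 \<le> t" "t \<le> 834 / 1000" "log_Lambda_deriv t = 0"
    using IVT2[of log_Lambda_deriv "834 / 1000" 0 "5 / 6"] pos neg by auto
  with pos neg have "t \<noteq> 5 / 6" "t \<noteq> 834 / 1000" by (metis less_irrefl)+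
  with t that show ?thesis by force
qed

text \<open>The maximum is attained near \<open>0.83356\<close>. The point \<open>5 / 6 = 0.8333\<dots>\<close> is so close that the value
  there is accurate to six digits, and its sixth power is rational.\<close>

lemma Lambda_5_6: "Lambda (5 / 6) ^ 6 = 6 * (6 / 11) ^ 11 * (25 / 36) ^ 6"
proof -
  have "((1 / 6) powr (- 1 / 6)) ^ 6 = (1 / 6 :: real) powr (- 1)"
    by (simp add: powr_power)
  moreover have "((11 / 6) powr (- 11 / 6)) ^ 6 = (11 / 6 :: real) powr (- 11)"
    by (simp add: powr_power)
  moreover have "(1 / 6 :: real) powr (- 1) = 6" by (simp add: powr_minus)
  moreover have "(11 / 6 :: real) powr (- 11) = (6 / 11) ^ 11"
      by (simp add: powr_minus powr_numeral power_divide)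
  ultimately show ?thesis by (simp add: Lambda_def power_mult_distrib power_divide)
qed

lemma Lambda_5_6_bounds: "308119 / 1000000 < Lambda (5 / 6)" "Lambda (5 / 6) < 308121 / 1000000"
proof -
  have pos: "Lambda (5 / 6) > 0" by (simp add: Lambda_def)
  have "(308119 / 1000000) ^ 6 < Lambda (5 / 6) ^ 6" "Lambda (5 / 6) ^ 6 < (308121 / 1000000) ^ 6"
    unfolding Lambda_5_6 by (simp_all add: power_divide)
  then show "308119 / 1000000 < Lambda (5 / 6)" "Lambda (5 / 6) < 308121 / 1000000"
    using power_less_imp_less_base[of _ 6] pos
        by (meson less_imp_le zero_le_divide_iff zero_le_numeral)+
qed

definition Lambda_argmax :: real where
  "Lambda_argmax = (SOME t. 5 / 6 < t \<and> t < 834 / 1000 \<and> log_Lambda_deriv t = 0)"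

lemma Lambda_argmax: "5 / 6 < Lambda_argmax" "Lambda_argmax < 834 / 1000"
    "log_Lambda_deriv Lambda_argmax = 0"
proof -
  have "\<exists>t. 5 / 6 < t \<and> t < 834 / 1000 \<and> log_Lambda_deriv t = 0"
    using Lambda_critical_point by metis
  from someI_ex[OF this] show "5 / 6 < Lambda_argmax" "Lambda_argmax < 834 / 1000"
      "log_Lambda_deriv Lambda_argmax = 0"
    unfolding Lambda_argmax_def by blast+
qed

lemma Lambda_le_argmax: "t \<in> {0<..<1} \<Longrightarrow> Lambda t \<le> Lambda Lambda_argmax"
  using log_Lambda_tangent[of Lambda_argmax t] Lambda_argmax by (simp add: Lambda_eq_exp)

lemma Lambda_star_eq: "Lambda_star = Lambda Lambda_argmax"
  unfolding Lambda_star_def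
  by (rule cSup_eq_maximum) (use Lambda_argmax Lambda_le_argmax in auto)

text \<open>The lower bound has to exceed \<open>1 / (1.0331 * pi) = 0.308111\<dots>\<close> for the case \<open>m = 1\<close> of the
  theorem; the upper bound is what \<open>kappa < 0.27755\<close> requires.\<close>

lemma Lambda_star_bounds: "308119 / 1000000 < Lambda_star" "Lambda_star < 30813 / 100000"
proof -
  show "308119 / 1000000 < Lambda_star"
    using Lambda_le_argmax[of "5 / 6"] Lambda_5_6_bounds(1) by (simp add: Lambda_star_eq)
  have "log_Lambda Lambda_argmax
      \<le> log_Lambda (5 / 6) + log_Lambda_deriv (5 / 6) * (Lambda_argmax - 5 / 6)"
    using Lambda_argmax by (intro log_Lambda_tangent) auto
  \<comment> \<open>The slope \<open>12 / 5 - ln 11\<close> is below \<open>12 / 5 - 43 / 18 = 1 / 90\<close>.\<close>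
  also have "log_Lambda_deriv (5 / 6) * (Lambda_argmax - 5 / 6) \<le> (1 / 80) * (1 / 1000)"
    using Lambda_argmax ln_11_bounds(1) by (intro mult_mono) (auto simp: log_Lambda_deriv_def)
  finally have "Lambda_star \<le> Lambda (5 / 6) * exp (1 / 80000)"
    using Lambda_argmax unfolding Lambda_star_eq by (simp add: Lambda_eq_exp exp_add[symmetric])
  also have "exp (1 / 80000 :: real) \<le> 1 + 2 / 80000"
    using exp_bound_half[of "1 / 80000 :: real"] exp_bound[of "1 / 80000 :: real"]
        by (simp add: power2_eq_square)
  also have "Lambda (5 / 6) * (1 + 2 / 80000) \<le> 308121 / 1000000 * (1 + 2 / 80000)"
    using Lambda_5_6_bounds(2) by (intro mult_right_mono) auto
  finally show "Lambda_star < 30813 / 100000" 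
    using Lambda_5_6_bounds by (simp add: mult_left_mono)
qed

lemma kappa_square: "kappa\<^sup>2 = Lambda_star / 4"
  using Lambda_star_bounds by (simp add: kappa_def)

lemma kappa_bounds: "0.27754 \<le> kappa" "kappa < 0.27755"
proof -
  show "0.27754 \<le> kappa"
    unfolding kappa_def by (rule real_le_rsqrt)
        (use Lambda_star_bounds in \<open>simp add: power2_eq_square\<close>)
  show "kappa < 0.27755"
    unfolding kappa_def by (rule real_less_lsqrt)
        (use Lambda_star_bounds in \<open>simp_all add: power2_eq_square\<close>)
qed

text \<open>At the critical point \<open>ln ((1 + t) / (1 - t)) = 2 / t\<close>, and this eliminates the exponents that
  depend on \<open>t\<close>.\<close>

lemma Lambda_star_closed_form:
  "Lambda_star = (Lambda_argmax / exp 1)\<^sup>2 / ((1 - Lambda_argmax) * (1 + Lambda_argmax))"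
proof -
  let ?t = "Lambda_argmax"
  have t: "0 < ?t" "?t < 1" using Lambda_argmax by auto
  have "ln (1 + ?t) - ln (1 - ?t) = 2 / ?t"
    using Lambda_argmax(3) t by (simp add: log_Lambda_deriv_def ln_div)
  then have "?t * (ln (1 + ?t) - ln (1 - ?t)) = 2" using t by simp
  then have "log_Lambda ?t = 2 * (ln ?t - 1) - (ln (1 - ?t) + ln (1 + ?t))"
    by (simp add: log_Lambda_def algebra_simps)
  then have "Lambda_star = (exp (ln ?t - 1))\<^sup>2 / (exp (ln (1 - ?t)) * exp (ln (1 + ?t)))"
    using t by (simp only: Lambda_star_eq Lambda_eq_exp greaterThanLessThan_iff exp_diff[of "2 * _"]
        exp_double exp_add)
  then show ?thesis using t by (simp add: exp_diff)
qed

section \<open>The closed-form bound on the remainder\<close>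

text \<open>Convexity of the even power, applied to the arithmetic mean.\<close>

lemma power_mean_even:
  fixes z :: "'i \<Rightarrow> real"
  assumes "finite I" "I \<noteq> {}" "even N" "N > 0"
  shows "(\<Sum>i\<in>I. z i) ^ N \<le> real (card I) ^ (N - 1) * (\<Sum>i\<in>I. z i ^ N)"
proof -
  define c where "c = real (card I)"
  have c: "c > 0" using assms by (simp add: c_def card_gt_0_iff)
  have "(\<Sum>i\<in>I. (1 / c) *\<^sub>R z i) ^ N \<le> (\<Sum>i\<in>I. (1 / c) * z i ^ N)"
    using assms c by (intro convex_on_sum[OF _ _ convex_power_even]) (auto simp: c_def)
  then have "(\<Sum>i\<in>I. z i) ^ N / c ^ N \<le> (\<Sum>i\<in>I. z i ^ N) / c"
    by (simp add: sum_divide_distrib[symmetric] power_divide)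
  then have "(\<Sum>i\<in>I. z i) ^ N \<le> (\<Sum>i\<in>I. z i ^ N) / c * c ^ N"
    using c by (simp add: field_simps)
  also have "\<dots> = c ^ (N - 1) * (\<Sum>i\<in>I. z i ^ N)"
    using c assms(4) by (cases N) auto
  finally show ?thesis by (simp add: c_def)
qed

lemma mpow_single: "mpow v (\<chi> s. if s = r then N else 0) = v $ r ^ N"
proof -
  have "mpow v (\<chi> s. if s = r then N else 0) = (\<Prod>s\<in>UNIV. if s = r then v $ s ^ N else 1)"
    unfolding mpow_def by (intro prod.cong) auto
  then show ?thesis by simp
qed

lemma integral_power_component:
  "((\<lambda>v :: real ^ 'p. v $ r ^ N) has_integral 1 / (real N + 1)) (cbox 0 1)"
proof -
  have "((\<lambda>v :: real ^ 'p. mpow v (\<chi> s. if s = r then N else 0)) has_integral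
      (\<Prod>s\<in>UNIV. 1 / (real ((\<chi> s. if s = r then N else 0 :: nat ^ 'p) $ s) + 1))) (cbox 0 1)"
    unfolding integral_mpow_unit[symmetric]
    by (intro integrable_integral integrable_continuous continuous_intros)
  also have "(\<Prod>s\<in>UNIV. 1 / (real ((\<chi> s. if s = r then N else 0 :: nat ^ 'p) $ s) + 1))
      = (\<Prod>s\<in>UNIV. if s = r then 1 / (real N + 1) else 1)"
    by (intro prod.cong) auto
  finally show ?thesis by (simp add: mpow_single)
qed

text \<open>Since \<open>1 / (a + 1)\<close> is the integral of \<open>t ^ a\<close> over the unit interval, the multinomial theorem
  makes the left-hand side \<open>1 / N!\<close> times the integral of \<open>(\<Sum>r. y $ r * v $ r) ^ N\<close> over the unit
  cube. The power mean inequality then separates the coordinates, and the factor \<open>1 / (N + 1)\<close> comes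
  from integrating \<open>v $ r ^ N\<close>.\<close>

lemma sum_multi_index_le:
  fixes y :: "real ^ 'p"
  assumes "even N" "N > 0"
  shows "(\<Sum>a\<in>{a. msize a = N}. mpow y a / mfact (a + 1))
    \<le> real CARD('p) ^ (N - 1) / fact (N + 1) * (\<Sum>r\<in>UNIV. (y $ r) ^ N)"
proof -
  have "((\<lambda>v. \<Sum>a\<in>{a. msize a = N}. fact N / mfact a * mpow y a * mpow v a) has_integral
     (\<Sum>a\<in>{a. msize a = N}. fact N / mfact a * mpow y a * (\<Prod>r\<in>UNIV. 1 / (real (a $ r) + 1))))
         (cbox 0 1)"
    unfolding integral_mpow_unit[symmetric]
    by (intro has_integral_sum has_integral_mult_right finite_msize integrable_integral
        integrable_continuous continuous_intros)
  also have "(\<lambda>v. \<Sum>a\<in>{a. msize a = N}. fact N / mfact a * mpow y a * mpow v a)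
      = (\<lambda>v. (\<Sum>r\<in>UNIV. y $ r * v $ r) ^ N)"
  proof
    fix v :: "real ^ 'p"
    have "mpow (y * v) a = mpow y a * mpow v a" for a
      by (simp add: mpow_def power_mult_distrib prod.distrib)
    then show "(\<Sum>a\<in>{a. msize a = N}. fact N / mfact a * mpow y a * mpow v a)
        = (\<Sum>r\<in>UNIV. y $ r * v $ r) ^ N"
      using multinomial_vec[of "y * v" N] by (simp add: mult.assoc)
  qed
  finally have lhs: "((\<lambda>v. (\<Sum>r\<in>UNIV. y $ r * v $ r) ^ N) has_integral
     (\<Sum>a\<in>{a. msize a = N}. fact N / mfact a * mpow y a * (\<Prod>r\<in>UNIV. 1 / (real (a $ r) + 1))))
         (cbox 0 1)" .
  have rhs: "((\<lambda>v. real CARD('p) ^ (N - 1) * (\<Sum>r\<in>UNIV. (y $ r) ^ N * (v $ r) ^ N)) has_integral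
     real CARD('p) ^ (N - 1) * (\<Sum>r\<in>UNIV. (y $ r) ^ N * (1 / (real N + 1)))) (cbox 0 1)"
    by (intro has_integral_sum has_integral_mult_right integral_power_component) simp
  have "(\<Sum>a\<in>{a. msize a = N}. fact N / mfact a * mpow y a * (\<Prod>r\<in>UNIV. 1 / (real (a $ r) + 1)))
     \<le> real CARD('p) ^ (N - 1) * (\<Sum>r\<in>UNIV. (y $ r) ^ N * (1 / (real N + 1)))"
  proof (rule has_integral_le[OF lhs rhs])
    fix v :: "real ^ 'p"
    show "(\<Sum>r\<in>UNIV. y $ r * v $ r) ^ N
        \<le> real CARD('p) ^ (N - 1) * (\<Sum>r\<in>UNIV. (y $ r) ^ N * (v $ r) ^ N)"
      using power_mean_even[of "UNIV :: 'p set" N "\<lambda>r. y $ r * v $ r"] assms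
          by (simp add: power_mult_distrib)
  qed
  also have "(\<Sum>a\<in>{a. msize a = N}. fact N / mfact a * mpow y a * (\<Prod>r\<in>UNIV. 1 / (real (a $ r) + 1)))
     = fact N * (\<Sum>a\<in>{a. msize a = N}. mpow y a / mfact (a + 1))"
    by (simp add: sum_distrib_left mfact_Suc prod_dividef)
  also have "real CARD('p) ^ (N - 1) * (\<Sum>r\<in>UNIV. (y $ r) ^ N * (1 / (real N + 1)))
     = fact N * (real CARD('p) ^ (N - 1) / fact (N + 1) * (\<Sum>r\<in>UNIV. (y $ r) ^ N))"
  proof -
    have "(fact (N + 1) :: real) = (real N + 1) * fact N" by simp
    then show ?thesis by (simp add: sum_divide_distrib[symmetric] add.commute)
  qed
  finally show ?thesis by (subst (asm) mult_le_cancel_left_pos) (rule fact_gt_zero)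
qed

definition abs_moment :: "nat \<Rightarrow> nat \<Rightarrow> real" where
  "abs_moment m k = (\<Sum>j=1..m. \<bar>gam m j\<bar> * real j * real j ^ k)"

lemma abs_gam_times: "j \<ge> 1 \<Longrightarrow> \<bar>gam m j\<bar> * real j
    = 2 * real ((2 * m) choose (m + j)) / real ((2 * m) choose m)"
  by (simp add: gam_def abs_mult power_abs)

lemma abs_moment_nonneg: "abs_moment m k \<ge> 0"
  unfolding abs_moment_def by (intro sum_nonneg) auto

text \<open>After the coordinates have been separated, the sum over \<open>j\<close> factors: one coordinate carries
  the power \<open>2 * m\<close> and each of the others contributes the moment of order zero.\<close>

lemma abs_bound_by_moments:
  assumes "m \<ge> 1"
  shows "(\<Sum>a\<in>{a::nat ^ 'p. msize a = 2 * m}. 1 / mfact (a + 1) *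
      (\<Sum>j\<in>{1..vec (int m)}. \<bar>gamv m j\<bar> * mpow (rvec j) (a + 1)))
    \<le> real CARD('p) ^ (2 * m) / fact (2 * m + 1)
        * (abs_moment m 0 ^ (CARD('p) - 1) * abs_moment m (2 * m))"
proof -
  let ?J = "{1..vec (int m)} :: (int ^ 'p) set" and ?p = "real CARD('p)"
  have "(\<Sum>a\<in>{a::nat ^ 'p. msize a = 2 * m}. 1 / mfact (a + 1) *
      (\<Sum>j\<in>?J. \<bar>gamv m j\<bar> * mpow (rvec j) (a + 1)))
    = (\<Sum>j\<in>?J. \<bar>gamv m j\<bar> * mpow (rvec j) 1
        * (\<Sum>a\<in>{a::nat ^ 'p. msize a = 2 * m}. mpow (rvec j) a / mfact (a + 1)))"
    unfolding sum_distrib_left mpow_add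
    by (subst sum.swap) (intro sum.cong refl, simp)
  also have "\<dots> \<le> (\<Sum>j\<in>?J. \<bar>gamv m j\<bar> * mpow (rvec j) 1 *
      (?p ^ (2 * m - 1) / fact (2 * m + 1) * (\<Sum>r\<in>UNIV. (rvec j $ r) ^ (2 * m))))"
    using assms mpow_rvec_nonneg by (intro sum_mono mult_left_mono sum_multi_index_le
        mult_nonneg_nonneg) auto
  also have "\<dots> = ?p ^ (2 * m - 1) / fact (2 * m + 1) *
      (\<Sum>r\<in>UNIV. \<Sum>j\<in>?J. \<bar>gamv m j\<bar> * mpow (rvec j) 1 * (rvec j $ r) ^ (2 * m))"
    unfolding sum_distrib_left by (subst sum.swap) (intro sum.cong refl, simp)
  also have "(\<Sum>r\<in>UNIV. \<Sum>j\<in>?J. \<bar>gamv m j\<bar> * mpow (rvec j) 1 * (rvec j $ r) ^ (2 * m))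
      = (\<Sum>r\<in>(UNIV :: 'p set). abs_moment m 0 ^ (CARD('p) - 1) * abs_moment m (2 * m))"
  proof (rule sum.cong[OF refl])
    fix r :: 'p
    have nat: "(\<Sum>x\<in>{1..int m}. \<bar>gam m (nat x)\<bar> * real_of_int x * real_of_int x ^ k)
        = abs_moment m k" for k
      unfolding abs_moment_def by (rule sum.reindex_bij_witness[of _ int nat]) auto
    have "\<bar>gamv m j\<bar> * mpow (rvec j) 1 * (rvec j $ r) ^ (2 * m)
      = (\<Prod>s\<in>UNIV. \<bar>gam m (nat (j $ s))\<bar> * real_of_int (j $ s)
          * real_of_int (j $ s) ^ (if s = r then 2 * m else 0))" for j
      using mpow_single[of "rvec j" r "2 * m"]
      by (simp add: gamv_def mpow_def rvec_def prod.distrib abs_prod)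
    then have "(\<Sum>j\<in>?J. \<bar>gamv m j\<bar> * mpow (rvec j) 1 * (rvec j $ r) ^ (2 * m))
      = (\<Sum>j\<in>?J. \<Prod>s\<in>UNIV. \<bar>gam m (nat (j $ s))\<bar> * real_of_int (j $ s)
          * real_of_int (j $ s) ^ (if s = r then 2 * m else 0))"
      by simp
    also have "\<dots> = (\<Prod>s\<in>UNIV. abs_moment m (if s = r then 2 * m else 0))"
      by (subst sum_box_prod[where g
          = "\<lambda>s x. \<bar>gam m (nat x)\<bar> * real_of_int x * real_of_int x ^ (if s = r then 2 * m else 0)"])
        (simp add: nat[symmetric])
    also have "\<dots> = abs_moment m (2 * m) * (\<Prod>s\<in>UNIV - {r}. abs_moment m 0)"
      by (subst prod.remove[of _ r]) auto
    finally show "(\<Sum>j\<in>?J. \<bar>gamv m j\<bar> * mpow (rvec j) 1 * (rvec j $ r) ^ (2 * m))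
      = abs_moment m 0 ^ (CARD('p) - 1) * abs_moment m (2 * m)"
      by (simp add: card_Diff_singleton)
  qed
  also have "\<dots> = ?p * (abs_moment m 0 ^ (CARD('p) - 1) * abs_moment m (2 * m))" by simp
  also have "?p ^ (2 * m - 1) / fact (2 * m + 1)
      * (?p * (abs_moment m 0 ^ (CARD('p) - 1) * abs_moment m (2 * m)))
    = ?p ^ (2 * m) / fact (2 * m + 1) * (abs_moment m 0 ^ (CARD('p) - 1) * abs_moment m (2 * m))"
    using assms power_Suc[of ?p "2 * m - 1"] by simp
  finally show ?thesis .
qed

text \<open>The moment is \<open>4 ^ m / (2 * m choose m) - 1\<close>, half of the binomial row being summed twice, and
  subtracting \<open>1\<close> more than makes up for the difference between \<open>sqrt (pi * (m + 1 / 2))\<close> and \<open>sqrt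
  (pi * m)\<close>.\<close>

lemma abs_moment_0_le:
  assumes "m \<ge> 1"
  shows "abs_moment m 0 \<le> sqrt (pi * real m)"
proof -
  define C where "C = real ((2 * m) choose m)"
  have C: "C > 0" by (simp add: C_def)
  have "abs_moment m 0 = (\<Sum>j=1..m. 2 * real ((2 * m) choose (m + j)) / C)"
    unfolding abs_moment_def C_def by (intro sum.cong refl) (simp add: abs_gam_times)
  also have "\<dots> = 2 * (\<Sum>j=1..m. real ((2 * m) choose (m + j))) / C"
    by (simp add: sum_distrib_left sum_divide_distrib)
  also have "2 * (\<Sum>j=1..m. real ((2 * m) choose (m + j))) = 4 ^ m - C"
  proof -
    have "(\<Sum>k\<le>2 * m. real ((2 * m) choose k)) = C + 2 * (\<Sum>j=1..m. real ((2 * m) choose (m + j)))"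
      unfolding C_def by (rule sum_symmetric_atMost) (simp add: binomial_central_symmetric)
    moreover have "(\<Sum>k\<le>2 * m. real ((2 * m) choose k)) = 4 ^ m"
      using choose_row_sum[of "2 * m"] by (simp add: power_mult flip: of_nat_sum)
    ultimately show ?thesis by simp
  qed
  also have "(4 ^ m - C) / C = 4 ^ m / C - 1" using C by (simp add: field_simps)
  also have "4 ^ m / C \<le> 1 + sqrt (pi * real m)"
  proof (rule power2_le_imp_le)
    have "pi / 2 \<le> 2" using pi_less_4 by simp
    also have "1 * 1 \<le> pi * real m" using assms pi_gt3 by (intro mult_mono) auto
    then have "1 \<le> sqrt (pi * real m)" by simp
    then have "2 \<le> 1 + 2 * sqrt (pi * real m)" by linarith
    finally have "pi * (real m + 1 / 2) \<le> pi * real m + (1 + 2 * sqrt (pi * real m))"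
        by (simp add: algebra_simps)
    also have "\<dots> = (1 + sqrt (pi * real m))\<^sup>2" by (simp add: power2_sum)
    finally show "(4 ^ m / C)\<^sup>2 \<le> (1 + sqrt (pi * real m))\<^sup>2"
      using central_binomial_wallis[of m] unfolding C_def by linarith
  qed simp
  finally show ?thesis by simp
qed

text \<open>A Chernoff bound that is exact at the exponential scale: the tangent to the logarithm at \<open>t\<close>
  gives \<open>x \<le> t / e * exp (x / t)\<close>, after which the sum is part of a binomial expansion. For the
  maximiser \<open>t\<close> of \<open>Lambda\<close> we have \<open>exp (2 / t) = (1 + t) / (1 - t)\<close>, and the base of the resulting
  \<open>m\<close>-th power is \<open>4 * Lambda_star\<close>.\<close>

lemma exponential_majorant_sum:
  assumes "m \<ge> 1"
  shows "(\<Sum>j=1..m. real ((2 * m) choose (m + j)) * (real j / real m) ^ (2 * m))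
      \<le> 4 ^ m * Lambda_star ^ m"
proof -
  define t where "t = Lambda_argmax"
  define y where "y = exp (2 / t)"
  have t: "0 < t" "t < 1" using Lambda_argmax by (auto simp: t_def)
  have y: "y = (1 + t) / (1 - t)"
  proof -
    have "2 / t = ln ((1 + t) / (1 - t))" using Lambda_argmax(3)
        by (simp add: t_def log_Lambda_deriv_def)
    then show ?thesis unfolding y_def using t by simp
  qed
  have y_pos: "y > 0" by (simp add: y_def)
  have majorant: "(real j / real m) ^ (2 * m) \<le> (t / exp 1) ^ (2 * m) * y ^ j" for j
  proof -
    define x where "x = real j / real m"
    have "x / t \<le> exp (x / t - 1)" using exp_ge_add_one_self[of "x / t - 1"] by simp
    then have "x \<le> exp (x / t) / exp 1 * t" by (simp only: exp_diff pos_divide_le_eq[OF t(1)])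
    then have "x \<le> t / exp 1 * exp (x / t)" by (simp add: mult.commute)
    then have "x ^ (2 * m) \<le> (t / exp 1 * exp (x / t)) ^ (2 * m)"
      by (intro power_mono) (auto simp: x_def)
    also have "\<dots> = (t / exp 1) ^ (2 * m) * exp (x / t) ^ (2 * m)" by (rule power_mult_distrib)
    also have "exp (x / t) ^ (2 * m) = exp (real (2 * m) * (x / t))"
        by (rule exp_of_nat_mult[symmetric])
    also have "real (2 * m) * (x / t) = real j * (2 / t)" using assms by (simp add: x_def)
    also have "exp (real j * (2 / t)) = y ^ j" unfolding y_def by (rule exp_of_nat_mult)
    finally show ?thesis by (simp add: x_def)
  qed
  have "(\<Sum>j=1..m. real ((2 * m) choose (m + j)) * (real j / real m) ^ (2 * m))
     \<le> (\<Sum>j=1..m. real ((2 * m) choose (m + j)) * ((t / exp 1) ^ (2 * m) * y ^ j))"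
    by (intro sum_mono mult_left_mono majorant) simp
  also have "\<dots> = (t / exp 1) ^ (2 * m) / y ^ m
      * (\<Sum>j=1..m. real ((2 * m) choose (m + j)) * y ^ (m + j))"
    using y_pos by (simp add: sum_distrib_left power_add mult_ac)
  also have "\<dots> \<le> (t / exp 1) ^ (2 * m) / y ^ m * (1 + y) ^ (2 * m)"
  proof (rule mult_left_mono)
    have "(\<Sum>j=1..m. real ((2 * m) choose (m + j)) * y ^ (m + j))
        = (\<Sum>k\<in>(\<lambda>j. m + j) ` {1..m}. real ((2 * m) choose k) * y ^ k)"
      by (subst sum.reindex) auto
    also have "\<dots> \<le> (\<Sum>k\<le>2 * m. real ((2 * m) choose k) * y ^ k)"
      using y_pos by (intro sum_mono2) auto
    also have "\<dots> = (1 + y) ^ (2 * m)"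
      using binomial_ring[of y 1 "2 * m"] by (simp add: add.commute)
    finally show "(\<Sum>j=1..m. real ((2 * m) choose (m + j)) * y ^ (m + j)) \<le> (1 + y) ^ (2 * m)" .
  qed (use t y_pos in simp)
  also have "\<dots> = ((t / exp 1)\<^sup>2 * ((1 + y)\<^sup>2 / y)) ^ m"
    by (simp add: power_mult power_mult_distrib power_divide)
  also have "(1 + y)\<^sup>2 / y = 4 / ((1 - t) * (1 + t))"
  proof -
    have "1 + y = 2 / (1 - t)" using t by (simp add: y field_simps)
    then have "(1 + y)\<^sup>2 / y = (2 / (1 - t))\<^sup>2 / y" by (simp only:)
    also have "\<dots> = 4 / ((1 - t) * (1 + t))"
      unfolding y using t by (simp add: power2_eq_square divide_simps)
    finally show ?thesis .
  qed
  also have "(t / exp 1)\<^sup>2 * (4 / ((1 - t) * (1 + t))) = 4 * Lambda_star"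
    by (simp add: Lambda_star_closed_form t_def)
  finally show ?thesis by (simp add: power_mult_distrib)
qed

text \<open>By the exponential majorant and Wallis's inequality the claim comes down to \<open>4 * (m + 1 / 2) \<le>
  pi * m\<^sup>2\<close>, which is true from \<open>m = 2\<close> on and false for \<open>m = 1\<close>.\<close>

lemma abs_moment_top_le:
  assumes "m \<ge> 2"
  shows "abs_moment m (2 * m) \<le> pi * real m * Lambda_star ^ m * real m ^ (2 * m)"
proof -
  define C where "C = real ((2 * m) choose m)"
  have C: "C > 0" by (simp add: C_def)
  have "abs_moment m (2 * m) = (\<Sum>j=1..m. 2 * real ((2 * m) choose (m + j)) / C * real j ^ (2 * m))"
    unfolding abs_moment_def C_def by (intro sum.cong refl) (simp add: abs_gam_times)
  also have "\<dots> = 2 * real m ^ (2 * m) / C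
      * (\<Sum>j=1..m. real ((2 * m) choose (m + j)) * (real j / real m) ^ (2 * m))"
    unfolding sum_distrib_left using assms by (intro sum.cong refl) (simp add: power_divide)
  also have "\<dots> \<le> 2 * real m ^ (2 * m) / C * (4 ^ m * Lambda_star ^ m)"
    using assms C by (intro mult_left_mono exponential_majorant_sum) auto
  also have "\<dots> = 2 * (4 ^ m / C) * (Lambda_star ^ m * real m ^ (2 * m))" by simp
  also have "\<dots> \<le> pi * real m * (Lambda_star ^ m * real m ^ (2 * m))"
  proof (rule mult_right_mono)
    have "4 * (pi * (real m + 1 / 2)) \<le> (pi * real m)\<^sup>2"
    proof -
      have "4 * (real m + 1 / 2) \<le> 3 * (real m * 2)" using assms by simp
      also have "\<dots> \<le> pi * (real m * real m)"
        using assms pi_gt3 by (intro mult_mono) auto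
      finally have "pi * (4 * (real m + 1 / 2)) \<le> pi * (pi * (real m * real m))"
          by (intro mult_left_mono) auto
      then show ?thesis by (simp add: power2_eq_square mult_ac)
    qed
    moreover have "(2 * (4 ^ m / C))\<^sup>2 = 4 * (4 ^ m / C)\<^sup>2" by (simp only: power_mult_distrib) simp
    ultimately have "(2 * (4 ^ m / C))\<^sup>2 \<le> (pi * real m)\<^sup>2"
      using central_binomial_wallis[of m] unfolding C_def by linarith
    then show "2 * (4 ^ m / C) \<le> pi * real m" by (rule power2_le_imp_le) simp
  qed (use Lambda_star_bounds in simp)
  finally show ?thesis by (simp add: mult_ac)
qed

text \<open>For \<open>m = 1\<close> the moment is exactly \<open>1\<close>, so that \<open>1.0331\<close> is only just large enough: the
  right-hand side is about \<open>1.00003\<close>.\<close>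

lemma abs_moment_top_le_1: "abs_moment 1 2 \<le> 1.0331 * (pi * Lambda_star)"
proof -
  have "abs_moment 1 2 = 1" by (simp add: abs_moment_def gam_def eval_nat_numeral)
  also have "1 \<le> 1.0331 * (3.14159 * (308119 / 1000000 :: real))" by simp
  also have "\<dots> \<le> 1.0331 * (pi * Lambda_star)"
    using pi_approx(1) Lambda_star_bounds(1) by (intro mult_left_mono mult_mono) auto
  finally show ?thesis .
qed

text \<open>The square root of \<open>pi * m\<close> occurs \<open>p - 1\<close> times from the moments of order zero and twice from
  the top moment. The factor \<open>Lambda_star ^ m\<close> of the latter and the prefactor \<open>1 / 4 ^ m\<close> make up
  \<open>kappa ^ (2 * m)\<close>.\<close>

lemma absolute_bound_le:
  fixes c :: real
  assumes m: "m \<ge> 1" and M: "M \<ge> 0" and c: "c \<ge> 0"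
    and top: "abs_moment m (2 * m) \<le> c * (pi * real m * Lambda_star ^ m * real m ^ (2 * m))"
  shows "M / 2 ^ (2 * m) * (\<Sum>a\<in>{a::nat ^ 'p. msize a = 2 * m}. 1 / mfact (a + 1) *
      (\<Sum>j\<in>{1..vec (int m)}. \<bar>gamv m j\<bar> * mpow (rvec j) (a + 1)))
    \<le> M * (c * (pi * real m) powr ((real CARD('p) + 1) / 2) / fact (2 * m + 1)) *
        (kappa * real CARD('p) * real m) ^ (2 * m)"
proof -
  let ?p = "real CARD('p)"
  have pm: "pi * real m > 0" using m by simp
  have card: "CARD('p) = Suc (CARD('p) - 1)" by simp
  have pow: "(pi * real m) powr ((?p + 1) / 2)
      = sqrt (pi * real m) ^ (CARD('p) - 1) * (pi * real m)"
  proof -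
    have half_power: "(pi * real m) powr (real k * (1 / 2)) = sqrt (pi * real m) ^ k" for k
    proof -
      have "(pi * real m) powr (real k * (1 / 2)) = ((pi * real m) powr (1 / 2)) powr real k"
        by (simp add: powr_powr)
      then show ?thesis using pm by (simp add: powr_half_sqrt powr_realpow)
    qed
    have "(pi * real m) powr ((?p + 1) / 2)
        = (pi * real m) powr (real (CARD('p) - 1) * (1 / 2) + 1)"
      by (subst (1) card) (simp add: field_simps)
    also have "\<dots> = sqrt (pi * real m) ^ (CARD('p) - 1) * (pi * real m)"
      unfolding powr_add half_power using pm by simp
    finally show ?thesis .
  qed
  have kap: "(kappa * ?p * real m) ^ (2 * m)
      = Lambda_star ^ m / 2 ^ (2 * m) * (?p ^ (2 * m) * real m ^ (2 * m))"
  proof -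
    have "kappa ^ (2 * m) = Lambda_star ^ m / 2 ^ (2 * m)"
      by (simp add: power_mult kappa_square power_divide)
    then show ?thesis by (simp add: power_mult_distrib)
  qed
  have "M / 2 ^ (2 * m) * (\<Sum>a\<in>{a::nat ^ 'p. msize a = 2 * m}. 1 / mfact (a + 1) *
      (\<Sum>j\<in>{1..vec (int m)}. \<bar>gamv m j\<bar> * mpow (rvec j) (a + 1)))
    \<le> M / 2 ^ (2 * m) * (?p ^ (2 * m) / fact (2 * m + 1)
        * (abs_moment m 0 ^ (CARD('p) - 1) * abs_moment m (2 * m)))"
    using M by (intro mult_left_mono abs_bound_by_moments m) auto
  also have "\<dots> \<le> M / 2 ^ (2 * m)
      * (?p ^ (2 * m) / fact (2 * m + 1) * (sqrt (pi * real m) ^ (CARD('p) - 1) *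
      (c * (pi * real m * Lambda_star ^ m * real m ^ (2 * m)))))"
    using M top by (intro mult_left_mono mult_mono power_mono abs_moment_0_le m abs_moment_nonneg)
        auto
  also have "\<dots> = M * (c * (pi * real m) powr ((?p + 1) / 2) / fact (2 * m + 1))
      * (kappa * ?p * real m) ^ (2 * m)"
    unfolding pow kap by (simp add: mult_ac)
  finally show ?thesis .
qed

section \<open>The theorem\<close>

lemma exists_multi_index: "\<exists>a :: nat ^ 'p. msize a = N"
proof -
  obtain r :: 'p where True by simp
  have "msize ((\<chi> s. if s = r then N else 0) :: nat ^ 'p) = N" by (simp add: msize_def)
  then show ?thesis by blast
qed

theorem theorem2p1:
  fixes f :: "real ^ 'p \<Rightarrow> real" and n :: "int ^ 'p" and m :: nat
  assumes "m \<ge> 1" and "cont_diff (2 * m) f" and "n \<ge> 0"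
  shows
    "(\<Sum>k\<in>{0..n - 1}. f (rvec k)) = Am m n f - Rm m n f
     \<and> Am m n f = (\<Sum>j\<in>{1..vec (int m)}. gamv m j *
         (\<Sum>i\<in>{0..j - 1}. oint (- 1 + rvec j /\<^sub>R 2 - rvec i) (rvec n - 1 + rvec j /\<^sub>R 2 - rvec i) f))
     \<and> Am m n f = (\<Sum>b\<in>{vec (1 - int m)..vec (int m - 1)}. tauv m (1 + vabs b) *
         oint (rvec b /\<^sub>R 2 - 1 /\<^sub>R 2) (rvec n - 1 /\<^sub>R 2 - rvec b /\<^sub>R 2) f)
     \<and> Am m n f = (\<Sum>b\<in>{vec (1 - int m)..vec (int m - 1)}. tauv m (1 + vabs b) *
         oint (- 1 /\<^sub>R 2 - rvec b /\<^sub>R 2) (rvec n - 1 /\<^sub>R 2 - rvec b /\<^sub>R 2) f)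
     \<and> Am m n f = (\<Sum>a\<in>{0..vec (int m - 1)}. tauv m (1 + a) *
         (\<Sum>b\<in>{b. vabs b = a}. oint (rvec b /\<^sub>R 2 - 1 /\<^sub>R 2) (rvec n - 1 /\<^sub>R 2 - rvec b /\<^sub>R 2) f))
     \<and> Am m n f = (\<Sum>a\<in>{0..vec (int m - 1)}. tauv m (1 + a) *
         (\<Sum>b\<in>{b. vabs b = a}. oint (- 1 /\<^sub>R 2 - rvec b /\<^sub>R 2) (rvec n - 1 /\<^sub>R 2 - rvec b /\<^sub>R 2) f))

     \<and> (\<Sum>j::int ^ 'p\<in>{1..vec (int m)}. gamv m j * (\<Sum>i\<in>{0..j - 1}. 1)) = 1
     \<and> (\<Sum>j::int ^ 'p\<in>{1..vec (int m)}. gamv m j * mpow (rvec j) 1) = 1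
     \<and> (\<Sum>b::int ^ 'p\<in>{vec (1 - int m)..vec (int m - 1)}. tauv m (1 + vabs b)) = 1
     \<and> (\<Sum>a::int ^ 'p\<in>{0..vec (int m - 1)}. tauv m (1 + a) * (\<Sum>b\<in>{b. vabs b = a}. 1)) = 1

     \<and> (\<forall>M::real.
          (\<forall>(a::nat ^ 'p) (u::real ^ 'p).
             msize a = 2 * m \<longrightarrow> (\<forall>r. - real m / 2 < u $ r \<and> u $ r \<le> real m / 2) \<longrightarrow>
             \<bar>\<Sum>k\<in>{0..n - 1}. mderiv a f (rvec k + u)\<bar> \<le> M) \<longrightarrow>
          (let B = M / 2 ^ (2 * m) * (\<Sum>a\<in>{a::nat ^ 'p. msize a = 2 * m}. 1 / mfact (a + 1) *
                     (\<Sum>j\<in>{1..vec (int m)}. \<bar>gamv m j\<bar> * mpow (rvec j) (a + 1)));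
               C = (\<lambda>c. M * (c * (pi * real m) powr ((real CARD('p) + 1) / 2) / fact (2 * m + 1)) *
                     (kappa * real CARD('p) * real m) ^ (2 * m))
           in \<bar>Rm m n f\<bar> \<le> B \<and> B \<le> C 1.0331 \<and> (m \<ge> 2 \<longrightarrow> B \<le> C 1.001)))

     \<and> (\<exists>t\<in>{0<..<1}. Lambda t = Lambda_star) \<and> (\<forall>t\<in>{0<..<1}. Lambda t \<le> Lambda_star)
     \<and> 0.3081 \<le> Lambda_star \<and> Lambda_star < 0.3082
     \<and> 0.27754 \<le> kappa \<and> kappa < 0.27755"
proof -
  have cont: "continuous_on UNIV f" using assms(2) by (rule cont_diff_continuous)
  note tau = Am_eq_tau[OF cont, of m n] and tau_shifted = Am_eq_tau_shifted[OF cont, of m n]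
  have bounds: "let B = M / 2 ^ (2 * m) * (\<Sum>a\<in>{a::nat ^ 'p. msize a = 2 * m}. 1 / mfact (a + 1) *
                     (\<Sum>j\<in>{1..vec (int m)}. \<bar>gamv m j\<bar> * mpow (rvec j) (a + 1)));
               C = (\<lambda>c. M * (c * (pi * real m) powr ((real CARD('p) + 1) / 2) / fact (2 * m + 1)) *
                     (kappa * real CARD('p) * real m) ^ (2 * m))
           in \<bar>Rm m n f\<bar> \<le> B \<and> B \<le> C 1.0331 \<and> (m \<ge> 2 \<longrightarrow> B \<le> C 1.001)"
    if M: "\<forall>(a::nat ^ 'p) (u::real ^ 'p).
             msize a = 2 * m \<longrightarrow> (\<forall>r. - real m / 2 < u $ r \<and> u $ r \<le> real m / 2) \<longrightarrow>
             \<bar>\<Sum>k\<in>{0..n - 1}. mderiv a f (rvec k + u)\<bar> \<le> M" for M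
  proof -
    obtain a :: "nat ^ 'p" where a: "msize a = 2 * m" using exists_multi_index by blast
    have "\<bar>\<Sum>k\<in>{0..n - 1}. mderiv a f (rvec k + 0)\<bar> \<le> M"
      using M[rule_format, OF a, of 0] assms(1) by simp
    then have M0: "M \<ge> 0" by linarith
    have large: "abs_moment m (2 * m) \<le> c * (pi * real m * Lambda_star ^ m * real m ^ (2 * m))"
      if "m \<ge> 2" "c \<ge> 1" for c
    proof -
      have "0 \<le> pi * real m * Lambda_star ^ m * real m ^ (2 * m)" using Lambda_star_bounds by simp
      then have "1 * (pi * real m * Lambda_star ^ m * real m ^ (2 * m))
          \<le> c * (pi * real m * Lambda_star ^ m * real m ^ (2 * m))"
        using that by (intro mult_right_mono) auto
      then show ?thesis using abs_moment_top_le[OF that(1)] by linarith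
    qed
    have top: "abs_moment m (2 * m) \<le> 1.0331 * (pi * real m * Lambda_star ^ m * real m ^ (2 * m))"
    proof (cases "m = 1")
      case True
      then show ?thesis using abs_moment_top_le_1 by simp
    next
      case False
      then show ?thesis using assms(1) by (intro large) auto
    qed
    show ?thesis
      unfolding Let_def
    proof (intro conjI impI)
      show "\<bar>Rm m n f\<bar> \<le> M / 2 ^ (2 * m) * (\<Sum>a\<in>{a::nat ^ 'p. msize a = 2 * m}. 1 / mfact (a + 1) *
                     (\<Sum>j\<in>{1..vec (int m)}. \<bar>gamv m j\<bar> * mpow (rvec j) (a + 1)))"
        using M by (intro Rm_bound assms) auto
    qed (rule absolute_bound_le[OF assms(1) M0 _ top] absolute_bound_le[OF assms(1) M0 _ large];
        simp)+
  qed
  have grouped_count: "(\<Sum>a::int ^ 'p\<in>{0..vec (int m - 1)}. tauv m (1 + a) * (\<Sum>b\<in>{b. vabs b = a}. 1))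
      = 1"
    unfolding sum_group_vabs mult_1_right by (rule sum_tauv[OF assms(1)])
  have maximum: "\<exists>t\<in>{0<..<1}. Lambda t = Lambda_star"
    using Lambda_argmax by (intro bexI[of _ Lambda_argmax]) (auto simp: Lambda_star_eq)
  have star_bounds: "0.3081 \<le> Lambda_star" "Lambda_star < 0.3082" using Lambda_star_bounds
      by simp_all
  show ?thesis
    by (intro conjI sum_eq_Am_minus_Rm assms Am_eq_shifted[OF cont] tau tau_shifted
        tau[folded sum_group_vabs] tau_shifted[folded sum_group_vabs]
        sum_gamv_count sum_gamv_mpow_1 sum_tauv grouped_count allI impI bounds
        maximum star_bounds kappa_bounds ballI)
      (auto simp: Lambda_star_eq Lambda_le_argmax)
qed

end
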